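(* Let $U_0,B_0\in L^\infty(\mathbb{R}^3)$ be divergence free and let $U,B$ be the corresponding mild solution of MHD defined on an interval of regularity $[0,T)$. Let $\delta\in(0,1)$, $h=\frac{2}{\pi}\arcsin\frac{1-\delta^2}{1+\delta^2}$, $\alpha\ge\frac{1-h}{h}$, and $\gamma\in(0,1)$. Assume there exists $\epsilon>0$ such that for every $t_0\in(T-\epsilon,T)$, either (1) $t_0+T_4(t_0)>T$, or (2) there exists a time $t=t(t_0)\in[t_0+T_4(t_0)/4,\,t_0+T_4(t_0)]$ such that for every $x_0\in\mathbb{R}^3$ there exist $r_U,r_B$ for which: - $\Omega_U(t,M_U)$ is linearly $\delta$-sparse around $x_0$ at scale $r_U$, where $0<r_U\le\rho(T_4(t_0)/4)$ and $M_U=\frac{\gamma}{(2C_4)^\alpha}(\|U(t_0)\|_\infty+\|B(t_0)\|_\infty)$, and - $\Omega_B(t,M_B)$ is linearly $\delta$-sparse around $x_0$ at scale $r_B$, where $0<r_B\le\rho(T_4(t_0)/4)$ and $M_B=\frac{(1-\gamma^h)^{1/h}}{(2C_4)^\alpha}(\|U(t_0)\|_\infty+\|B(t_0)\|_\infty)$. Then $T$ is not a singular time.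
   Context: MHD on $\mathbb{R}^3$ with viscosity $\nu>0$ and magnetic diffusivity $\mu>0$; with $G_\lambda(x,t)=(2\pi\lambda t)^{-3/2}e^{-|x|^2/(4\lambda t)}$, a mild solution on $[0,T)$ with divergence-free data $U_0,B_0\in L^\infty$ is a pair $U,B\in C((0,T),L^\infty(\mathbb{R}^3))$ with $U_k(x,t)=\int G_\nu(x-w,t)U_{0k}(w)dw-\int_0^t\!\int\partial_jG_\nu(x-w,t-s)(U_jU_k-B_jB_k)(w,s)dwds-\int_0^t\!\int\partial_kG_\nu(x-w,t-s)\Pi(w,s)dwds$, $B_k(x,t)=\int G_\mu(x-w,t)B_{0k}(w)dw-\int_0^t\!\int\partial_jG_\mu(x-w,t-s)(U_jB_k-B_jU_k)(w,s)dwds$, $\Delta\Pi=-\partial_j\partial_k(U_jU_k-B_jB_k)$, $\Pi(\cdot,s)\in BMO$ (summation over repeated indices). "Interval of regularity $[0,T)$" means the mild solution exists on $[0,T)$ and is bounded in $L^\infty(\mathbb{R}^3)$ on $[0,T']$ for each $T'<T$; "$T$ is not a singular time" means $\|U(t)\|_\infty+\|B(t)\|_\infty$ stays bounded as $t\to T^-$ (so the solution can be extended beyond $T$). Standing analyticity data: $C_4\ge1$ is a fixed constant depending only on $\mu,\nu$ such that, for any time $s$ with $A(s)=\|U(s)\|_\infty+\|B(s)\|_\infty$, $T_4(s)=\frac{1}{16C_4^4A(s)^2}$, $T_\beta(s)=\frac{(2\beta-1)^2}{\beta^4}T_4(s)$ for $\beta\in(1/2,1]$, and $\rho(\tau)=\frac{\sqrt\tau}{2C_4}$: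 for $0<\tau<T_\beta(s)$ (within the existence interval), $U(\cdot,s+\tau)$ and $B(\cdot,s+\tau)$ extend analytically to $\{x+iy\in\mathbb{C}^3:|y|\le\rho(\tau)\}$ with the sum of the moduli of the extensions bounded by $2\beta C_4A(s)$ there. Super-level set: $\Omega_f(t,M)=\{x\in\mathbb{R}^3:|f(x,t)|>M\}$. A set $S\subset\mathbb{R}^3$ is linearly $\delta$-sparse around $x_0$ at scale $r>0$ if there is a unit vector $d\in S^2$ with $\frac{|S\cap(x_0-rd,x_0+rd)|}{2r}\le\delta$, where $|\cdot|$ is one-dimensional Lebesgue measure on the segment. *)

theory Defs
  imports "HOL-Analysis.Analysis" "HOL-Probability.Essential_Supremum"
begin

definition partial :: "3 \<Rightarrow> (real^3 \<Rightarrow> real) \<Rightarrow> real^3 \<Rightarrow> real" where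
  "partial j f x = deriv (\<lambda>h. f (x + h *\<^sub>R axis j 1)) 0"

fun ipartial :: "3 list \<Rightarrow> (real^3 \<Rightarrow> real) \<Rightarrow> real^3 \<Rightarrow> real" where
  "ipartial [] f = f"
| "ipartial (j # js) f = partial j (ipartial js f)"

definition test_fn :: "(real^3 \<Rightarrow> real) \<Rightarrow> bool" where
  "test_fn \<phi> \<longleftrightarrow> (\<exists>K. compact K \<and> (\<forall>x. x \<notin> K \<longrightarrow> \<phi> x = 0)) \<and>
     (\<forall>js. continuous_on UNIV (ipartial js \<phi>) \<and>
        (\<forall>j x. (\<lambda>h. ipartial js \<phi> (x + h *\<^sub>R axis j 1)) differentiable (at 0)))"

definition Linf :: "(real^3 \<Rightarrow> real^3) \<Rightarrow> bool" where
  "Linf f \<longleftrightarrow> f \<in> borel_measurable lborel \<and> esssup lborel (\<lambda>x. ereal (norm (f x))) < \<infinity>"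

definition linf :: "(real^3 \<Rightarrow> real^3) \<Rightarrow> real" where
  "linf f = real_of_ereal (esssup lborel (\<lambda>x. ereal (norm (f x))))"

definition div_free :: "(real^3 \<Rightarrow> real^3) \<Rightarrow> bool" where
  "div_free f \<longleftrightarrow> (\<forall>\<phi>. test_fn \<phi> \<longrightarrow>
     (\<Sum>k\<in>UNIV. \<integral>x. f x $ k * partial k \<phi> x \<partial>lborel) = 0)"

definition ball_avg :: "(real^3 \<Rightarrow> real) \<Rightarrow> real^3 \<Rightarrow> real \<Rightarrow> real" where
  "ball_avg f x r = (\<integral>y\<in>ball x r. f y \<partial>lborel) / measure lborel (ball x r)"

definition BMO :: "(real^3 \<Rightarrow> real) \<Rightarrow> bool" where
  "BMO f \<longleftrightarrow> (\<forall>x r. r > 0 \<longrightarrow> set_integrable lborel (ball x r) f) \<and>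
     (\<exists>C. \<forall>x r. r > 0 \<longrightarrow>
        (\<integral>y\<in>ball x r. \<bar>f y - ball_avg f x r\<bar> \<partial>lborel) / measure lborel (ball x r) \<le> C)"

definition G :: "real \<Rightarrow> real^3 \<Rightarrow> real \<Rightarrow> real" where
  "G lam x t = (2 * pi * lam * t) powr (-3/2) * exp (- (norm x)\<^sup>2 / (4 * lam * t))"

definition dG :: "real \<Rightarrow> 3 \<Rightarrow> real^3 \<Rightarrow> real \<Rightarrow> real" where
  "dG lam j x t = partial j (\<lambda>y. G lam y t) x"

definition duh :: "real \<Rightarrow> 3 \<Rightarrow> (real^3 \<Rightarrow> real \<Rightarrow> real) \<Rightarrow> real^3 \<Rightarrow> real
    \<Rightarrow> (real^3) \<times> real \<Rightarrow> real" where
  "duh lam j F x t p = indicator {0<..<t} (snd p) * dG lam j (x - fst p) (t - snd p) * F (fst p) (snd p)"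

definition heat :: "real \<Rightarrow> (real^3 \<Rightarrow> real) \<Rightarrow> real^3 \<Rightarrow> real \<Rightarrow> real^3 \<Rightarrow> real" where
  "heat lam f x t w = G lam (x - w) t * f w"

definition mhd_mild ::
  "real \<Rightarrow> real \<Rightarrow> (real^3 \<Rightarrow> real^3) \<Rightarrow> (real^3 \<Rightarrow> real^3) \<Rightarrow> real
    \<Rightarrow> (real^3 \<Rightarrow> real \<Rightarrow> real^3) \<Rightarrow> (real^3 \<Rightarrow> real \<Rightarrow> real^3) \<Rightarrow> bool" where
  "mhd_mild \<nu> \<mu> U0 B0 T U B \<longleftrightarrow>
     (\<forall>t\<in>{0<..<T}. Linf (\<lambda>x. U x t) \<and> Linf (\<lambda>x. B x t)) \<and>
     (\<forall>t\<in>{0<..<T}. ((\<lambda>s. linf (\<lambda>x. U x s - U x t)) \<longlongrightarrow> 0) (at t) \<and>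
                     ((\<lambda>s. linf (\<lambda>x. B x s - B x t)) \<longlongrightarrow> 0) (at t)) \<and>
     (\<exists>Pr :: real^3 \<Rightarrow> real \<Rightarrow> real.
        (\<forall>s\<in>{0<..<T}. BMO (\<lambda>w. Pr w s) \<and>
           (\<forall>\<phi>. test_fn \<phi> \<longrightarrow>
              (\<integral>x. Pr x s * (\<Sum>j\<in>UNIV. partial j (partial j \<phi>) x) \<partial>lborel)
              = - (\<Sum>j\<in>UNIV. \<Sum>k\<in>UNIV.
                     \<integral>x. (U x s $ j * U x s $ k - B x s $ j * B x s $ k)
                          * partial j (partial k \<phi>) x \<partial>lborel))) \<and>
        (\<forall>t\<in>{0<..<T}. \<forall>x. \<forall>k.
           integrable lborel (heat \<nu> (\<lambda>w. U0 w $ k) x t) \<and>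
           integrable lborel (heat \<mu> (\<lambda>w. B0 w $ k) x t) \<and>
           (\<forall>j. integrable lborel
                  (duh \<nu> j (\<lambda>w s. U w s $ j * U w s $ k - B w s $ j * B w s $ k) x t) \<and>
                integrable lborel
                  (duh \<mu> j (\<lambda>w s. U w s $ j * B w s $ k - B w s $ j * U w s $ k) x t)) \<and>
           integrable lborel (duh \<nu> k Pr x t) \<and>
           U x t $ k = (\<integral>w. heat \<nu> (\<lambda>w. U0 w $ k) x t w \<partial>lborel)
             - (\<Sum>j\<in>UNIV. \<integral>p. duh \<nu> j (\<lambda>w s. U w s $ j * U w s $ k - B w s $ j * B w s $ k) x t p \<partial>lborel)
             - (\<integral>p. duh \<nu> k Pr x t p \<partial>lborel) \<and>
           B x t $ k = (\<integral>w. heat \<mu> (\<lambda>w. B0 w $ k) x t w \<partial>lborel)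
             - (\<Sum>j\<in>UNIV. \<integral>p. duh \<mu> j (\<lambda>w s. U w s $ j * B w s $ k - B w s $ j * U w s $ k) x t p \<partial>lborel)))"

definition interval_of_regularity ::
  "real \<Rightarrow> real \<Rightarrow> (real^3 \<Rightarrow> real^3) \<Rightarrow> (real^3 \<Rightarrow> real^3) \<Rightarrow> real
    \<Rightarrow> (real^3 \<Rightarrow> real \<Rightarrow> real^3) \<Rightarrow> (real^3 \<Rightarrow> real \<Rightarrow> real^3) \<Rightarrow> bool" where
  "interval_of_regularity \<nu> \<mu> U0 B0 T U B \<longleftrightarrow> 0 < T \<and> mhd_mild \<nu> \<mu> U0 B0 T U B \<and>
     (\<forall>T' < T. \<exists>C. \<forall>t\<in>{0<..T'}. linf (\<lambda>x. U x t) + linf (\<lambda>x. B x t) \<le> C)"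

definition not_singular_time ::
  "real \<Rightarrow> (real^3 \<Rightarrow> real \<Rightarrow> real^3) \<Rightarrow> (real^3 \<Rightarrow> real \<Rightarrow> real^3) \<Rightarrow> bool" where
  "not_singular_time T U B \<longleftrightarrow>
     (\<exists>C. \<forall>\<^sub>F t in at_left T. linf (\<lambda>x. U x t) + linf (\<lambda>x. B x t) \<le> C)"

definition Anorm :: "(real^3 \<Rightarrow> real \<Rightarrow> real^3) \<Rightarrow> (real^3 \<Rightarrow> real \<Rightarrow> real^3) \<Rightarrow> real \<Rightarrow> real" where
  "Anorm U B s = linf (\<lambda>x. U x s) + linf (\<lambda>x. B x s)"

definition T4 :: "real \<Rightarrow> real \<Rightarrow> real" where
  "T4 C4 A = 1 / (16 * C4 ^ 4 * A\<^sup>2)"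

definition Tbeta :: "real \<Rightarrow> real \<Rightarrow> real \<Rightarrow> real" where
  "Tbeta \<beta> C4 A = (2 * \<beta> - 1)\<^sup>2 / \<beta> ^ 4 * T4 C4 A"

definition rho :: "real \<Rightarrow> real \<Rightarrow> real" where
  "rho C4 \<tau> = sqrt \<tau> / (2 * C4)"

definition cvec :: "real^3 \<Rightarrow> complex^3" where
  "cvec x = (\<chi> k. complex_of_real (x $ k))"

definition Imv :: "complex^3 \<Rightarrow> real^3" where
  "Imv z = (\<chi> k. Im (z $ k))"

text \<open>Holomorphic (= analytic) in several complex variables on a neighbourhood of S:
  complex-Frechet differentiable (derivative complex linear) on an open superset of S.\<close>
definition analytic3_on :: "(complex^3) set \<Rightarrow> (complex^3 \<Rightarrow> complex^3) \<Rightarrow> bool" where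
  "analytic3_on S F \<longleftrightarrow> (\<exists>S'. open S' \<and> S \<subseteq> S' \<and>
     (\<forall>z\<in>S'. \<exists>L. (F has_derivative L) (at z) \<and> (\<forall>c w. L (c *s w) = c *s L w)))"

definition strip :: "real \<Rightarrow> (complex^3) set" where
  "strip r = {z. norm (Imv z) \<le> r}"

definition analyticity_data ::
  "real \<Rightarrow> real \<Rightarrow> (real^3 \<Rightarrow> real \<Rightarrow> real^3) \<Rightarrow> (real^3 \<Rightarrow> real \<Rightarrow> real^3) \<Rightarrow> bool" where
  "analyticity_data C4 T U B \<longleftrightarrow> C4 \<ge> 1 \<and>
     (\<forall>s\<in>{0<..<T}. \<forall>\<beta>\<in>{1/2<..1}. \<forall>\<tau>. 0 < \<tau> \<and> \<tau> < Tbeta \<beta> C4 (Anorm U B s) \<and> s + \<tau> < T \<longrightarrow>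
        (\<exists>FU FB. analytic3_on (strip (rho C4 \<tau>)) FU \<and> analytic3_on (strip (rho C4 \<tau>)) FB \<and>
           (\<forall>x. FU (cvec x) = cvec (U x (s + \<tau>)) \<and> FB (cvec x) = cvec (B x (s + \<tau>))) \<and>
           (\<forall>z\<in>strip (rho C4 \<tau>). norm (FU z) + norm (FB z) \<le> 2 * \<beta> * C4 * Anorm U B s)))"

definition superlevel :: "(real^3 \<Rightarrow> real \<Rightarrow> real^3) \<Rightarrow> real \<Rightarrow> real \<Rightarrow> (real^3) set" where
  "superlevel f t M = {x. norm (f x t) > M}"

definition lin_sparse :: "(real^3) set \<Rightarrow> real \<Rightarrow> real^3 \<Rightarrow> real \<Rightarrow> bool" where
  "lin_sparse S \<delta> x0 r \<longleftrightarrow> (\<exists>d::real^3. norm d = 1 \<and>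
     measure lborel {s \<in> {-r<..<r}. x0 + s *\<^sub>R d \<in> S} / (2 * r) \<le> \<delta>)"

end

theory Submission
  imports Defs "HOL-Complex_Analysis.Complex_Analysis"
begin

text \<open>Suppose \<open>T\<close> is singular. Then alternative (2) holds at all times near \<open>T\<close>, and at its time \<open>t\<close> a
  two-constants estimate on the complex disc through \<open>x\<^sub>0\<close> in the sparse direction gives
  \<open>\<bar>U(x\<^sub>0,t)\<bar> \<le> \<gamma>\<^sup>h A(t\<^sub>0)\<close> and \<open>\<bar>B(x\<^sub>0,t)\<bar> \<le> (1 - \<gamma>\<^sup>h) A(t\<^sub>0)\<close>. So \<open>A\<close> does not increase, the time step
  \<open>T\<^sub>4/4\<close> does not shrink, and iteration passes \<open>T\<close>.

  The estimate needs the sharp bound \<open>h = 1 - (4/\<pi>) arctan \<delta>\<close> for the harmonic measure at \<open>0\<close> of a set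
  \<open>K \<subseteq> [-1,1]\<close> of length at least \<open>2 - 2\<delta>\<close>. For symmetric \<open>K\<close>, compare with
  \<open>[-1,-\<delta>] \<union> [\<delta>,1]\<close>: its equilibrium potential is discretised by a Blaschke product with explicit
  zeros (\<open>a / cosh u\<close> at equally spaced \<open>u\<close>, in the half-plane coordinate \<open>(1 - z\<^sup>2) / (1 + z\<^sup>2)\<close>), and
  each factor is dilated separately so that its zero falls into \<open>K\<close>. The general case reduces to
  \<open>K \<union> -K\<close> and \<open>K \<inter> -K\<close> by considering \<open>f(z) f(-z)\<close> and using the concavity of \<open>arctan\<close>.\<close>

section \<open>Integrals of the hyperbolic kernel\<close>

text \<open>Equal spacing in \<open>u\<close> is dictated by the Green function. In the coordinate
  (1 - z^2) / (1 + z^2), which takes values in the right half-plane, the Green function of a / cosh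
  u and a / cosh v is ln ((cosh u + cosh v) / |cosh u - cosh v|), a function of |u - v| plus the
  same function of u + v. Reflection at u = 0 thus turns the potential of a constant density on the
  half line into a convolution on the whole line. For density 1 it equals pi^2 / 2 on the model set
  and pi * \<psi> at the centre of the disc; the quotient 2 * \<psi> / pi is \<open>h\<close>.
  Finite products in place of potentials leave only the maximum modulus principle to apply. They
  cost factors polynomial in 1 / \<epsilon>, which vanish when \<open>f\<close> is raised to the
  power \<open>N\<close>, \<epsilon> is taken proportional to 1 / N and N-th roots are extracted.
  The coordinate depends on z^2 only, hence the detour through symmetric sets. A second obstacle is
  the endpoint t = t0 + T4: the analyticity data concern times strictly before it, so the disc
  estimate is proved for uniform limits of extendable fields.\<close>

lemma borel_measurable_cosh_real [measurable]: "(cosh :: real \<Rightarrow> real) \<in> borel_measurable borel"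
  by (intro borel_measurable_continuous_onI continuous_intros)

text \<open>With the denominator written as cos^2 x + sinh^2 u, the integrand is the
  \<open>u\<close>-derivative of arctan (sinh u / cos x). It is also the \<open>x\<close>-derivative
  of artanh (sin x / cosh u), which is how it enters the next lemma.\<close>

lemma nn_integral_sech_kernel:
  fixes x :: real
  assumes "0 \<le> x" "x < pi / 2"
  shows "(\<integral>\<^sup>+u. ennreal (cos x * cosh u / ((cosh u)\<^sup>2 - (sin x)\<^sup>2)) * indicator {0..} u \<partial>lborel) = ennreal (pi / 2)"
proof -
  have c: "cos x > 0" using assms pi_gt_zero by (intro cos_gt_zero_pi) linarith+
  have den: "(cosh u)\<^sup>2 - (sin x)\<^sup>2 = (cos x)\<^sup>2 + (sinh u)\<^sup>2" for u :: real
    using sin_cos_squared_add[of x] cosh_square_eq[of u] by linarith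
  have pos: "(cos x)\<^sup>2 + (sinh u)\<^sup>2 > 0" for u :: real
    using c by (simp add: add_pos_nonneg)
  have "(\<integral>\<^sup>+u. ennreal (cos x * cosh u / ((cosh u)\<^sup>2 - (sin x)\<^sup>2)) * indicator {0..} u \<partial>lborel)
      = ennreal (pi / 2 - arctan (sinh 0 / cos x))"
  proof (rule nn_integral_FTC_atLeast)
    show "(\<lambda>u. cos x * cosh u / ((cosh u)\<^sup>2 - (sin x)\<^sup>2)) \<in> borel_measurable borel"
      unfolding den by (intro borel_measurable_continuous_onI continuous_intros) (use pos in \<open>auto simp: less_imp_neq[symmetric]\<close>)
    show "DERIV (\<lambda>u. arctan (sinh u / cos x)) u :> cos x * cosh u / ((cosh u)\<^sup>2 - (sin x)\<^sup>2)" for u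
    proof -
      have e: "1 + (sinh u / cos x)\<^sup>2 = ((cos x)\<^sup>2 + (sinh u)\<^sup>2) / (cos x)\<^sup>2"
        using c by (simp add: field_simps)
      show ?thesis
        apply (rule derivative_eq_intros | use c in force)+
        unfolding den e using c pos[of u] by (simp add: field_simps power2_eq_square)
    qed
    show "0 \<le> cos x * cosh u / ((cosh u)\<^sup>2 - (sin x)\<^sup>2)" for u
      unfolding den using c pos[of u] by simp
    have "filterlim (\<lambda>u::real. 1 / cos x * sinh u) at_top at_top"
      using c by (intro filterlim_tendsto_pos_mult_at_top[OF tendsto_const _ sinh_real_at_top]) simp
    then have "filterlim (\<lambda>u::real. sinh u / cos x) at_top at_top" by simp
    then show "((\<lambda>u. arctan (sinh u / cos x)) \<longlongrightarrow> pi / 2) at_top"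
      by (rule filterlim_compose[OF tendsto_arctan_at_top])
  qed
  then show ?thesis by simp
qed

text \<open>Tonelli: the integrand is the integral of its derivative in \<^term>\<open>\<psi>\<close>.\<close>

lemma nn_integral_artanh_sech:
  fixes \<psi> :: real
  assumes psi: "0 \<le> \<psi>" "\<psi> \<le> pi / 2"
  shows "(\<integral>\<^sup>+u. ennreal (artanh (sin \<psi> / cosh u)) * indicator {0..} u \<partial>lborel) = ennreal (pi / 2 * \<psi>)"
proof -
  define k where "k = (\<lambda>x u::real. cos x * cosh u / ((cosh u)\<^sup>2 - (sin x)\<^sup>2))"
  have inner: "(\<integral>\<^sup>+x. ennreal (k x u) * indicator {0..\<psi>} x \<partial>lborel) = ennreal (artanh (sin \<psi> / cosh u))"
    if "u > 0" for u
  proof -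
    have ch: "cosh u > 1" using that cosh_real_strict_mono[of 0 u] by simp
    have lt: "\<bar>sin x / cosh u\<bar> < 1" for x
      using ch abs_sin_le_one[of x] le_less_trans[OF abs_sin_le_one[of x] ch] by (simp add: abs_divide)
    have sq: "(cosh u)\<^sup>2 - (sin x)\<^sup>2 > 0" for x
      using ch abs_sin_le_one[of x] le_less_trans[OF abs_sin_le_one[of x] ch]
      by (metis abs_of_pos diff_gt_0_iff_gt less_trans power2_abs power_strict_mono abs_ge_zero pos2 zero_less_one)
    have "(\<integral>\<^sup>+x. ennreal (k x u) * indicator {0..\<psi>} x \<partial>lborel)
       = ennreal (artanh (sin \<psi> / cosh u) - artanh (sin 0 / cosh u))"
    proof (rule nn_integral_FTC_Icc)
      show "(\<lambda>x. k x u) \<in> borel_measurable borel"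
        unfolding k_def by (intro borel_measurable_continuous_onI continuous_intros) (use sq in \<open>auto simp: less_imp_neq[symmetric]\<close>)
      show "DERIV (\<lambda>x. artanh (sin x / cosh u)) x :> k x u" if "x \<in> {0..\<psi>}" for x
      proof -
        have e: "1 - (sin x / cosh u)\<^sup>2 = ((cosh u)\<^sup>2 - (sin x)\<^sup>2) / (cosh u)\<^sup>2"
          using ch by (simp add: field_simps)
        have d: "((\<lambda>x. sin x / cosh u) has_real_derivative cos x / cosh u) (at x)"
          by (auto intro!: derivative_eq_intros)
        show ?thesis
          by (rule DERIV_cong[OF DERIV_chain2[OF artanh_real_has_field_derivative[OF lt] d]])
            (use ch sq[of x] in \<open>simp add: e k_def field_simps power2_eq_square\<close>)
      qed
      show "0 \<le> k x u" if "x \<in> {0..\<psi>}" for x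
        unfolding k_def using sq[of x] ch cos_ge_zero[of x] that psi by simp
    qed (use psi in auto)
    then show ?thesis by (simp add: artanh_def)
  qed
  have "(\<integral>\<^sup>+u. ennreal (artanh (sin \<psi> / cosh u)) * indicator {0..} u \<partial>lborel)
     = (\<integral>\<^sup>+u. (\<integral>\<^sup>+x. ennreal (k x u) * indicator {0..\<psi>} x * indicator {0..} u \<partial>lborel) \<partial>lborel)"
  proof (rule nn_integral_cong_AE)
    \<comment> \<open>For \<psi> = pi / 2, the case giving the potential on the model set, the
      kernel degenerates at \<open>u = 0\<close> and at \<open>x = pi / 2\<close>. Both points are
      discarded as null sets.\<close>
    have "AE u in lborel. u \<noteq> (0::real)" by (rule AE_lborel_singleton)
    then show "AE u in lborel. ennreal (artanh (sin \<psi> / cosh u)) * indicator {0..} u =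
        (\<integral>\<^sup>+x. ennreal (k x u) * indicator {0..\<psi>} x * indicator {0..} u \<partial>lborel)"
    proof eventually_elim
      case (elim u)
      show ?case
      proof (cases "u > 0")
        case True then show ?thesis using inner[of u] by simp
      next
        case False then show ?thesis using elim by simp
      qed
    qed
  qed
  also have "\<dots> = (\<integral>\<^sup>+x. (\<integral>\<^sup>+u. ennreal (k x u) * indicator {0..\<psi>} x * indicator {0..} u \<partial>lborel) \<partial>lborel)"
    unfolding k_def by (rule lborel_pair.Fubini') measurable
  also have "\<dots> = (\<integral>\<^sup>+x. ennreal (pi / 2) * indicator {0..\<psi>} x \<partial>lborel)"
  proof (rule nn_integral_cong_AE)
    have "AE x in lborel. x \<noteq> pi / 2" by (rule AE_lborel_singleton)
    then show "AE x in lborel. (\<integral>\<^sup>+u. ennreal (k x u) * indicator {0..\<psi>} x * indicator {0..} u \<partial>lborel)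
        = ennreal (pi / 2) * indicator {0..\<psi>} x"
    proof eventually_elim
      case (elim x)
      show ?case
      proof (cases "x \<in> {0..\<psi>}")
        case True
        then show ?thesis using nn_integral_sech_kernel[of x] elim psi by (simp add: k_def)
      qed auto
    qed
  qed
  also have "\<dots> = ennreal (pi / 2 * \<psi>)"
    using psi by (subst nn_integral_cmult_indicator) (auto simp: ennreal_mult[symmetric])
  finally show ?thesis .
qed

section \<open>Riemann sums of decreasing functions on the half line\<close>

lemma nn_integral_const_Ico:
  fixes c p q :: real
  assumes "0 \<le> c" "p \<le> q"
  shows "(\<integral>\<^sup>+u. ennreal c * indicator {p..<q} u \<partial>lborel) = ennreal ((q - p) * c)"
  using assms by (simp add: nn_integral_cmult_indicator ennreal_mult mult.commute)

text \<open>Each node is the right end of its cell of length \<epsilon>. The cells begin at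
  \<epsilon> / 2, so \<open>F\<close> may be singular at 0, as artanh (1 / cosh u) is.\<close>

lemma sum_le_nn_integral_decreasing:
  fixes F :: "real \<Rightarrow> real"
  assumes meas [measurable]: "F \<in> borel_measurable borel" and eps: "\<epsilon> > 0"
    and dec: "\<And>x y. 0 < x \<Longrightarrow> x \<le> y \<Longrightarrow> F y \<le> F x" and nn: "\<And>x. 0 < x \<Longrightarrow> 0 \<le> F x"
    and int: "(\<integral>\<^sup>+u. ennreal (F u) * indicator {0..} u \<partial>lborel) = ennreal C" and "C \<ge> 0"
  shows "(\<Sum>i<n. F ((real i + 3/2) * \<epsilon>)) \<le> C / \<epsilon>"
proof -
  have *: "ennreal (\<Sum>i<n. \<epsilon> * F ((real i + 3/2) * \<epsilon>))
      \<le> (\<integral>\<^sup>+u. ennreal (F u) * indicator {\<epsilon>/2..<(real n + 1/2) * \<epsilon>} u \<partial>lborel)"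
  proof (induction n)
    case (Suc n)
    have "ennreal (\<epsilon> * F ((real n + 3/2) * \<epsilon>))
       = (\<integral>\<^sup>+u. ennreal (F ((real n + 3/2) * \<epsilon>)) * indicator {(real n + 1/2) * \<epsilon>..<(real n + 3/2) * \<epsilon>} u \<partial>lborel)"
      using eps nn[of "(real n + 3/2) * \<epsilon>"]
      by (subst nn_integral_const_Ico) (auto simp: left_diff_distrib[symmetric])
    also have "\<dots> \<le> (\<integral>\<^sup>+u. ennreal (F u) * indicator {(real n + 1/2) * \<epsilon>..<(real n + 3/2) * \<epsilon>} u \<partial>lborel)"
    proof (intro nn_integral_mono)
      fix u
      have "F ((real n + 3/2) * \<epsilon>) \<le> F u" if "(real n + 1/2) * \<epsilon> \<le> u" "u < (real n + 3/2) * \<epsilon>"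
        using that eps less_le_trans[OF _ that(1), of 0] by (intro dec) auto
      then show "ennreal (F ((real n + 3/2) * \<epsilon>)) * indicator {(real n + 1/2) * \<epsilon>..<(real n + 3/2) * \<epsilon>} u
         \<le> ennreal (F u) * indicator {(real n + 1/2) * \<epsilon>..<(real n + 3/2) * \<epsilon>} u"
        by (auto split: split_indicator intro: ennreal_leI)
    qed
    finally have 1: "ennreal (\<epsilon> * F ((real n + 3/2) * \<epsilon>))
        \<le> (\<integral>\<^sup>+u. ennreal (F u) * indicator {(real n + 1/2) * \<epsilon>..<(real n + 3/2) * \<epsilon>} u \<partial>lborel)" .
    have "ennreal (\<Sum>i<Suc n. \<epsilon> * F ((real i + 3/2) * \<epsilon>))
       = ennreal (\<Sum>i<n. \<epsilon> * F ((real i + 3/2) * \<epsilon>)) + ennreal (\<epsilon> * F ((real n + 3/2) * \<epsilon>))"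
      using eps nn by (simp add: ennreal_plus[symmetric] sum_nonneg del: ennreal_plus)
    also have "\<dots> \<le> (\<integral>\<^sup>+u. ennreal (F u) * indicator {\<epsilon>/2..<(real n + 1/2) * \<epsilon>} u \<partial>lborel)
        + (\<integral>\<^sup>+u. ennreal (F u) * indicator {(real n + 1/2) * \<epsilon>..<(real n + 3/2) * \<epsilon>} u \<partial>lborel)"
      by (intro add_mono Suc 1)
    also have "\<dots> = (\<integral>\<^sup>+u. ennreal (F u) * indicator {\<epsilon>/2..<(real n + 1/2) * \<epsilon>} u
        + ennreal (F u) * indicator {(real n + 1/2) * \<epsilon>..<(real n + 3/2) * \<epsilon>} u \<partial>lborel)"
      by (rule nn_integral_add[symmetric]) measurable
    also have "\<dots> = (\<integral>\<^sup>+u. ennreal (F u) * indicator {\<epsilon>/2..<(real (Suc n) + 1/2) * \<epsilon>} u \<partial>lborel)"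
    proof (intro nn_integral_cong)
      fix u
      have "\<epsilon>/2 \<le> (real n + 1/2) * \<epsilon>" "(real n + 1/2) * \<epsilon> \<le> (real n + 3/2) * \<epsilon>"
        "(real (Suc n) + 1/2) * \<epsilon> = (real n + 3/2) * \<epsilon>"
        using eps by (auto simp: algebra_simps)
      then show "ennreal (F u) * indicator {\<epsilon>/2..<(real n + 1/2) * \<epsilon>} u
        + ennreal (F u) * indicator {(real n + 1/2) * \<epsilon>..<(real n + 3/2) * \<epsilon>} u
        = ennreal (F u) * indicator {\<epsilon>/2..<(real (Suc n) + 1/2) * \<epsilon>} u"
        unfolding \<open>(real (Suc n) + 1/2) * \<epsilon> = (real n + 3/2) * \<epsilon>\<close> by (auto split: split_indicator)
    qed
    finally show ?case .
  qed simp
  also have "\<dots> \<le> (\<integral>\<^sup>+u. ennreal (F u) * indicator {0..} u \<partial>lborel)"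
    using eps by (intro nn_integral_mono) (auto split: split_indicator)
  finally have "(\<Sum>i<n. \<epsilon> * F ((real i + 3/2) * \<epsilon>)) \<le> C"
    using int \<open>C \<ge> 0\<close> by simp
  then show ?thesis using eps by (simp add: sum_distrib_left[symmetric] field_simps)
qed

text \<open>Now each node is the left end of its cell. The initial half cell, next to 0, is paid for
  by \<open>F 0\<close>, and the 1 pays for cutting the improper integral off at a finite
  \<open>n\<close>.\<close>

lemma ex_sum_ge_nn_integral_decreasing:
  fixes F :: "real \<Rightarrow> real"
  assumes meas [measurable]: "F \<in> borel_measurable borel" and eps: "\<epsilon> > 0"
    and dec: "\<And>x y. 0 \<le> x \<Longrightarrow> x \<le> y \<Longrightarrow> F y \<le> F x" and nn: "\<And>x. 0 \<le> x \<Longrightarrow> 0 \<le> F x"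
    and int: "(\<integral>\<^sup>+u. ennreal (F u) * indicator {0..} u \<partial>lborel) = ennreal C" and "C \<ge> 0"
  shows "\<exists>n. (\<Sum>i<n. F ((real i + 1/2) * \<epsilon>)) \<ge> C / \<epsilon> - F 0 - 1"
proof -
  have *: "(\<integral>\<^sup>+u. ennreal (F u) * indicator {0..<(real n + 1/2) * \<epsilon>} u \<partial>lborel)
      \<le> ennreal (\<epsilon> * F 0 + (\<Sum>i<n. \<epsilon> * F ((real i + 1/2) * \<epsilon>)))" for n
  proof (induction n)
    case 0
    have "(\<integral>\<^sup>+u. ennreal (F u) * indicator {0..<(real 0 + 1/2) * \<epsilon>} u \<partial>lborel)
      \<le> (\<integral>\<^sup>+u. ennreal (F 0) * indicator {0..<\<epsilon>/2} u \<partial>lborel)"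
      by (intro nn_integral_mono) (auto split: split_indicator intro: ennreal_leI dec)
    also have "\<dots> = ennreal (\<epsilon>/2 * F 0)"
      using eps nn[of 0] by (subst nn_integral_const_Ico) auto
    also have "\<dots> \<le> ennreal (\<epsilon> * F 0)" using eps nn[of 0] by (intro ennreal_leI mult_right_mono) auto
    finally show ?case by simp
  next
    case (Suc n)
    have "(\<integral>\<^sup>+u. ennreal (F u) * indicator {0..<(real (Suc n) + 1/2) * \<epsilon>} u \<partial>lborel)
      = (\<integral>\<^sup>+u. ennreal (F u) * indicator {0..<(real n + 1/2) * \<epsilon>} u
        + ennreal (F u) * indicator {(real n + 1/2) * \<epsilon>..<(real n + 3/2) * \<epsilon>} u \<partial>lborel)"
    proof (intro nn_integral_cong)
      fix u
      have "0 \<le> (real n + 1/2) * \<epsilon>" "(real n + 1/2) * \<epsilon> \<le> (real n + 3/2) * \<epsilon>"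
        "(real (Suc n) + 1/2) * \<epsilon> = (real n + 3/2) * \<epsilon>"
        using eps by (auto simp: algebra_simps)
      then show "ennreal (F u) * indicator {0..<(real (Suc n) + 1/2) * \<epsilon>} u
        = ennreal (F u) * indicator {0..<(real n + 1/2) * \<epsilon>} u
        + ennreal (F u) * indicator {(real n + 1/2) * \<epsilon>..<(real n + 3/2) * \<epsilon>} u"
        unfolding \<open>(real (Suc n) + 1/2) * \<epsilon> = (real n + 3/2) * \<epsilon>\<close> by (auto split: split_indicator)
    qed
    also have "\<dots> = (\<integral>\<^sup>+u. ennreal (F u) * indicator {0..<(real n + 1/2) * \<epsilon>} u \<partial>lborel)
        + (\<integral>\<^sup>+u. ennreal (F u) * indicator {(real n + 1/2) * \<epsilon>..<(real n + 3/2) * \<epsilon>} u \<partial>lborel)"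
      by (rule nn_integral_add) measurable
    also have "\<dots> \<le> ennreal (\<epsilon> * F 0 + (\<Sum>i<n. \<epsilon> * F ((real i + 1/2) * \<epsilon>))) 
        + (\<integral>\<^sup>+u. ennreal (F ((real n + 1/2) * \<epsilon>)) * indicator {(real n + 1/2) * \<epsilon>..<(real n + 3/2) * \<epsilon>} u \<partial>lborel)"
    proof (intro add_mono Suc nn_integral_mono)
      fix u
      have "F u \<le> F ((real n + 1/2) * \<epsilon>)" if "(real n + 1/2) * \<epsilon> \<le> u"
        using that eps by (intro dec) auto
      then show "ennreal (F u) * indicator {(real n + 1/2) * \<epsilon>..<(real n + 3/2) * \<epsilon>} u
        \<le> ennreal (F ((real n + 1/2) * \<epsilon>)) * indicator {(real n + 1/2) * \<epsilon>..<(real n + 3/2) * \<epsilon>} u"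
        by (auto split: split_indicator intro: ennreal_leI)
    qed
    also have "(\<integral>\<^sup>+u. ennreal (F ((real n + 1/2) * \<epsilon>)) * indicator {(real n + 1/2) * \<epsilon>..<(real n + 3/2) * \<epsilon>} u \<partial>lborel)
        = ennreal (\<epsilon> * F ((real n + 1/2) * \<epsilon>))"
      using eps nn[of "(real n + 1/2) * \<epsilon>"]
      by (subst nn_integral_const_Ico) (auto simp: left_diff_distrib[symmetric])
    also have "ennreal (\<epsilon> * F 0 + (\<Sum>i<n. \<epsilon> * F ((real i + 1/2) * \<epsilon>))) + ennreal (\<epsilon> * F ((real n + 1/2) * \<epsilon>))
        = ennreal (\<epsilon> * F 0 + (\<Sum>i<Suc n. \<epsilon> * F ((real i + 1/2) * \<epsilon>)))"
      using eps nn by (simp add: ennreal_plus[symmetric] sum_nonneg add.assoc del: ennreal_plus)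
    finally show ?case .
  qed
  have sup: "(SUP n. \<integral>\<^sup>+u. ennreal (F u) * indicator {0..<(real n + 1/2) * \<epsilon>} u \<partial>lborel) = ennreal C"
  proof -
    have "(SUP n. \<integral>\<^sup>+u. ennreal (F u) * indicator {0..<(real n + 1/2) * \<epsilon>} u \<partial>lborel)
       = (\<integral>\<^sup>+u. (SUP n. ennreal (F u) * indicator {0..<(real n + 1/2) * \<epsilon>} u) \<partial>lborel)"
    proof (rule nn_integral_monotone_convergence_SUP[symmetric])
      show "incseq (\<lambda>n u. ennreal (F u) * indicator {0..<(real n + 1/2) * \<epsilon>} u)"
      proof (intro incseq_SucI le_funI)
        fix n u
        have "(real n + 1/2) * \<epsilon> \<le> (real (Suc n) + 1/2) * \<epsilon>" using eps by (intro mult_right_mono) auto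
        then show "ennreal (F u) * indicator {0..<(real n + 1/2) * \<epsilon>} u
           \<le> ennreal (F u) * indicator {0..<(real (Suc n) + 1/2) * \<epsilon>} u"
          by (auto simp: indicator_def)
      qed
    qed measurable
    also have "\<dots> = (\<integral>\<^sup>+u. ennreal (F u) * indicator {0..} u \<partial>lborel)"
    proof (intro nn_integral_cong)
      fix u :: real
      obtain N where N: "u / \<epsilon> < real N" using reals_Archimedean2 by blast
      then have N': "u < (real N + 1/2) * \<epsilon>" using eps by (simp add: field_simps)
      show "(SUP n. ennreal (F u) * indicator {0..<(real n + 1/2) * \<epsilon>} u) = ennreal (F u) * indicator {0..} u"
      proof (rule antisym)
        show "(SUP n. ennreal (F u) * indicator {0..<(real n + 1/2) * \<epsilon>} u) \<le> ennreal (F u) * indicator {0..} u"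
          by (intro SUP_least) (auto split: split_indicator)
        show "ennreal (F u) * indicator {0..} u \<le> (SUP n. ennreal (F u) * indicator {0..<(real n + 1/2) * \<epsilon>} u)"
          by (rule SUP_upper2[of N]) (use N' in \<open>auto split: split_indicator\<close>)
      qed
    qed
    finally show ?thesis using int by simp
  qed
  show ?thesis
  proof (cases "C - \<epsilon> < 0")
    case True
    have "C / \<epsilon> < 1" using True eps by simp
    then show ?thesis by (intro exI[of _ 0]) (use nn[of 0] in auto)
  next
    case False
    have "ennreal (C - \<epsilon>) < (SUP n. \<integral>\<^sup>+u. ennreal (F u) * indicator {0..<(real n + 1/2) * \<epsilon>} u \<partial>lborel)"
      unfolding sup using False eps by (simp add: ennreal_less_iff)
    then obtain n where "ennreal (C - \<epsilon>) < (\<integral>\<^sup>+u. ennreal (F u) * indicator {0..<(real n + 1/2) * \<epsilon>} u \<partial>lborel)"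
      by (auto simp: less_SUP_iff)
    with *[of n] have "ennreal (C - \<epsilon>) < ennreal (\<epsilon> * F 0 + (\<Sum>i<n. \<epsilon> * F ((real i + 1/2) * \<epsilon>)))"
      by (rule less_le_trans[rotated])
    then have "C - \<epsilon> < \<epsilon> * F 0 + (\<Sum>i<n. \<epsilon> * F ((real i + 1/2) * \<epsilon>))"
      using False by (subst (asm) ennreal_less_iff) auto
    then have "C - \<epsilon> < \<epsilon> * (F 0 + (\<Sum>i<n. F ((real i + 1/2) * \<epsilon>)))"
      by (simp add: sum_distrib_left algebra_simps)
    then have "(C - \<epsilon>) / \<epsilon> < F 0 + (\<Sum>i<n. F ((real i + 1/2) * \<epsilon>))"
      using eps by (simp add: divide_less_eq mult.commute)
    then show ?thesis using eps by (intro exI[of _ n]) (simp add: diff_divide_distrib)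
  qed
qed

section \<open>The logarithmic kernel in the coordinate u\<close>

lemma artanh_mono_real:
  fixes x y :: real
  assumes "-1 < x" "x \<le> y" "y < 1"
  shows "artanh x \<le> artanh y"
proof -
  have "(1 + x) / (1 - x) \<le> (1 + y) / (1 - y)" using assms by (intro frac_le) auto
  moreover have "0 < (1 + x) / (1 - x)" using assms by simp
  ultimately show ?thesis unfolding artanh_def by simp
qed

lemma artanh_sech_antimono:
  fixes a x y :: real
  assumes "0 \<le> a" "a < cosh x" "0 \<le> x" "x \<le> y"
  shows "artanh (a / cosh y) \<le> artanh (a / cosh x)"
proof (rule artanh_mono_real)
  have c: "cosh x \<le> cosh y" using assms by (simp add: cosh_real_nonneg_le_iff)
  show "a / cosh y \<le> a / cosh x" using assms c by (intro divide_left_mono) auto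
  have "0 \<le> a / cosh y" using assms by simp
  then show "- 1 < a / cosh y" by linarith
  show "a / cosh x < 1" using assms by simp
qed

lemma borel_measurable_artanh_sech [measurable]:
  "(\<lambda>u::real. artanh (a / cosh u)) \<in> borel_measurable borel"
  unfolding artanh_def by measurable

lemma exp_artanh_sech:
  fixes x :: real
  assumes "x > 0"
  shows "exp (artanh (1 / cosh x)) = cosh (x/2) / sinh (x/2)"
proof -
  have s: "sinh (x/2) > 0" using assms by simp
  have c: "cosh x = 2 * (sinh (x/2))\<^sup>2 + 1" using cosh_double[of "x/2"] cosh_square_eq[of "x/2"] by simp
  have c': "cosh x = 2 * (cosh (x/2))\<^sup>2 - 1" using c cosh_square_eq[of "x/2"] by simp
  have "1 + 1 / cosh x = (cosh x + 1) / cosh x" "1 - 1 / cosh x = (cosh x - 1) / cosh x"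
    by (simp_all add: field_simps)
  then have "(1 + 1 / cosh x) / (1 - 1 / cosh x) = (cosh x + 1) / (cosh x - 1)" by simp
  also have "\<dots> = (cosh (x/2))\<^sup>2 / (sinh (x/2))\<^sup>2"
    by (subst c', subst c) simp
  also have "\<dots> = (cosh (x/2) / sinh (x/2))\<^sup>2" by (simp add: power_divide)
  finally have "artanh (1 / cosh x) = ln (cosh (x/2) / sinh (x/2))"
    using s by (simp add: artanh_def ln_realpow)
  then show ?thesis using s by simp
qed

text \<open>The sum-to-product formulas give coth (|u - v| / 2) * coth ((u + v) / 2). Writing coth
  through artanh (1 / cosh) makes the exponent summable by \<open>nn_integral_artanh_sech\<close> at
  \<psi> = pi / 2.\<close>

lemma cosh_ratio_eq_exp:
  fixes u v :: real
  assumes "0 \<le> u" "0 \<le> v" "u \<noteq> v"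
  shows "(cosh u + cosh v) / \<bar>cosh u - cosh v\<bar>
    = exp (artanh (1 / cosh \<bar>u - v\<bar>) + artanh (1 / cosh (u + v)))"
proof -
  have p: "u + v > 0" "\<bar>u - v\<bar> > 0" using assms by auto
  have a: "cosh u + cosh v = 2 * cosh ((u+v)/2) * cosh ((u-v)/2)"
    using cosh_add[of "(u+v)/2" "(u-v)/2"] cosh_diff[of "(u+v)/2" "(u-v)/2"] by (simp add: field_simps)
  have b: "cosh u - cosh v = 2 * sinh ((u+v)/2) * sinh ((u-v)/2)"
    using cosh_add[of "(u+v)/2" "(u-v)/2"] cosh_diff[of "(u+v)/2" "(u-v)/2"] by (simp add: field_simps)
  have "\<bar>sinh y\<bar> = sinh \<bar>y\<bar>" "cosh y = cosh \<bar>y\<bar>" for y :: real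
    by (auto simp: abs_if)
  from this[of "(u - v) / 2"]
  have sc: "\<bar>sinh ((u-v)/2)\<bar> = sinh (\<bar>u-v\<bar>/2)" "cosh ((u-v)/2) = cosh (\<bar>u-v\<bar>/2)"
    by simp_all
  show ?thesis
    unfolding exp_add exp_artanh_sech[OF p(1)] exp_artanh_sech[OF p(2)] a b abs_mult sc
    using p by (simp add: mult.commute)
qed

text \<open>Used at \<epsilon> / 4: the node \<epsilon> / 2, which the integral comparison leaves
  out, costs only a factor polynomial in 1 / \<epsilon>.\<close>

lemma coth_le:
  fixes y :: real
  assumes "y > 0"
  shows "cosh y / sinh y \<le> 1 + 1 / y"
proof -
  have "sinh 0 - 0 \<le> sinh y - y"
    by (rule DERIV_nonneg_imp_nondecreasing[of 0 y])
      (use assms in \<open>auto intro!: derivative_eq_intros exI cosh_real_ge_1\<close>)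
  then have s: "sinh y \<ge> y" by simp
  have "cosh y - sinh y \<le> 1" using assms by (simp add: cosh_minus_sinh)
  also have "1 \<le> sinh y / y" using s assms by simp
  finally show ?thesis using s assms by (simp add: field_simps)
qed

text \<open>The omitted node \<open>v m\<close> is the midpoint of the cell containing
  \<open>u\<close> and may coincide with \<open>u\<close>. Distances from \<open>u\<close> to the
  nodes on its right dominate v 0, v 1, and so on. Those on its left dominate v 0, ..., v (m - 1),
  and the reflected distances u + v j continue this list from v m on. Hence the exponent is at most
  twice a sum of \<open>F\<close> over the nodes.\<close>

lemma prod_cosh_ratio_le:
  fixes \<epsilon> u :: real
  assumes eps: "\<epsilon> > 0" and u: "u \<ge> 0"
  defines "v \<equiv> \<lambda>j::nat. (real j + 1/2) * \<epsilon>"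
  shows "\<exists>m. (\<forall>j. j \<noteq> m \<longrightarrow> u \<noteq> v j) \<and>
    (\<Prod>j\<in>{..<n} - {m}. (cosh u + cosh (v j)) / \<bar>cosh u - cosh (v j)\<bar>) \<le> (1 + 4 / \<epsilon>)\<^sup>2 * exp (pi\<^sup>2 / (2 * \<epsilon>))"
proof -
  define F where "F = (\<lambda>x::real. artanh (1 / cosh x))"
  define m where "m = nat \<lfloor>u / \<epsilon>\<rfloor>"
  have m: "real m * \<epsilon> \<le> u" "u < (real m + 1) * \<epsilon>"
  proof -
    have "of_int \<lfloor>u / \<epsilon>\<rfloor> = real m" using u eps by (simp add: m_def)
    then have "real m \<le> u / \<epsilon>" "u / \<epsilon> < real m + 1" by linarith+
    then show "real m * \<epsilon> \<le> u" "u < (real m + 1) * \<epsilon>" using eps by (auto simp: field_simps)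
  qed
  have Fdec: "F y \<le> F x" if "0 < x" "x \<le> y" for x y
    unfolding F_def using that cosh_real_strict_mono[of 0 x] by (intro artanh_sech_antimono) auto
  have Fnn: "0 \<le> F x" if "0 < x" for x
  proof -
    have "artanh 0 \<le> F x" unfolding F_def using that cosh_real_strict_mono[of 0 x] by (intro artanh_mono_real) auto
    then show ?thesis by simp
  qed
  \<comment> \<open>The node \<epsilon> / 2 is kept apart; the nodes from 3 * \<epsilon> / 2 on are
    bounded by the integral pi^2 / 4 of \<open>F\<close>, divided by \<epsilon>.\<close>
  define S where "S = F (\<epsilon>/2) + pi\<^sup>2 / (4 * \<epsilon>)"
  have sumF: "(\<Sum>i<N. F (v i)) \<le> S" for N
  proof -
    have "(\<integral>\<^sup>+u. ennreal (F u) * indicator {0..} u \<partial>lborel) = ennreal (pi\<^sup>2 / 4)"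
      using nn_integral_artanh_sech[of "pi/2"] by (simp add: F_def power2_eq_square)
    then have "(\<Sum>i<N. F ((real i + 3/2) * \<epsilon>)) \<le> pi\<^sup>2 / 4 / \<epsilon>"
      using eps Fdec Fnn by (intro sum_le_nn_integral_decreasing) (auto simp: F_def)
    moreover have "(\<Sum>i<N. F (v i)) \<le> (\<Sum>i<Suc N. F (v i))"
      using Fnn eps by (intro sum_mono2) (auto simp: v_def)
    moreover have "(\<Sum>i<Suc N. F (v i)) = F (\<epsilon>/2) + (\<Sum>i<N. F ((real i + 3/2) * \<epsilon>))"
      by (subst sum.lessThan_Suc_shift) (simp add: v_def algebra_simps)
    ultimately show ?thesis by (simp add: S_def)
  qed
  have vpos: "0 < v i" for i using eps by (simp add: v_def)
  have gt: "F \<bar>u - v j\<bar> \<le> F (v (j - m - 1))" if "j > m" for j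
  proof (rule Fdec[OF vpos])
    have "v (j - m - 1) = (real j - real m - 1 / 2) * \<epsilon>" using that by (simp add: v_def of_nat_diff)
    also have "\<dots> = v j - (real m + 1) * \<epsilon>" by (simp add: v_def algebra_simps)
    also have "\<dots> \<le> v j - u" using m by simp
    finally show "v (j - m - 1) \<le> \<bar>u - v j\<bar>" by linarith
  qed
  have lt: "F \<bar>u - v j\<bar> \<le> F (v (m - j - 1))" if "j < m" for j
  proof (rule Fdec[OF vpos])
    have "v (m - j - 1) = (real m - real j - 1 / 2) * \<epsilon>" using that by (simp add: v_def of_nat_diff)
    also have "\<dots> = real m * \<epsilon> - v j" by (simp add: v_def algebra_simps)
    also have "\<dots> \<le> u - v j" using m by simp
    finally show "v (m - j - 1) \<le> \<bar>u - v j\<bar>" by linarith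
  qed
  have pl: "F (u + v j) \<le> F (v (m + j))" for j
  proof (rule Fdec[OF vpos])
    have "v (m + j) = real m * \<epsilon> + v j" by (simp add: v_def algebra_simps)
    then show "v (m + j) \<le> u + v j" using m by simp
  qed
  have ne: "u \<noteq> v j" if "j \<noteq> m" for j
  proof
    assume "u = v j"
    then have "real m \<le> real j + 1/2" "real j + 1/2 < real m + 1"
      using m eps by (auto simp: v_def)
    then show False using that by linarith
  qed
  have split: "{..<n} - {m} = {..<min n m} \<union> {m<..<n}" by auto
  have s1: "(\<Sum>j\<in>{m<..<n}. F \<bar>u - v j\<bar>) \<le> S"
  proof -
    have "(\<Sum>j\<in>{m<..<n}. F \<bar>u - v j\<bar>) \<le> (\<Sum>j\<in>{m<..<n}. F (v (j - m - 1)))"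
      by (intro sum_mono gt) auto
    also have "\<dots> = (\<Sum>i<n - m - 1. F (v i))"
      by (rule sum.reindex_bij_witness[of _ "\<lambda>i. i + m + 1" "\<lambda>j. j - m - 1"]) auto
    finally show ?thesis using sumF[of "n - m - 1"] by linarith
  qed
  have s2: "(\<Sum>j<min n m. F \<bar>u - v j\<bar>) + (\<Sum>j\<in>{..<n} - {m}. F (u + v j)) \<le> S"
  proof -
    have "(\<Sum>j<min n m. F \<bar>u - v j\<bar>) \<le> (\<Sum>j<min n m. F (v (m - j - 1)))"
      by (intro sum_mono lt) auto
    also have "\<dots> = (\<Sum>i\<in>(\<lambda>j. m - j - 1) ` {..<min n m}. F (v i))"
      by (subst sum.reindex) (auto simp: inj_on_def)
    also have "\<dots> \<le> (\<Sum>i<m. F (v i))"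
      using Fnn vpos by (intro sum_mono2) auto
    finally have 1: "(\<Sum>j<min n m. F \<bar>u - v j\<bar>) \<le> (\<Sum>i<m. F (v i))" .
    have "(\<Sum>j\<in>{..<n} - {m}. F (u + v j)) \<le> (\<Sum>j<n. F (u + v j))"
      using Fnn vpos u by (intro sum_mono2) (auto intro: add_nonneg_pos)
    also have "\<dots> \<le> (\<Sum>j<n. F (v (m + j)))" by (intro sum_mono pl)
    also have "\<dots> = (\<Sum>i\<in>{m..<m+n}. F (v i))"
      by (rule sum.reindex_bij_witness[of _ "\<lambda>i. i - m" "\<lambda>j. m + j"]) auto
    finally have "(\<Sum>j<min n m. F \<bar>u - v j\<bar>) + (\<Sum>j\<in>{..<n} - {m}. F (u + v j))
       \<le> (\<Sum>i<m. F (v i)) + (\<Sum>i\<in>{m..<m+n}. F (v i))" using 1 by linarith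
    also have "\<dots> = (\<Sum>i<m+n. F (v i))"
      by (subst sum.union_disjoint[symmetric]) (auto intro!: sum.cong)
    finally show ?thesis using sumF[of "m+n"] by linarith
  qed
  have "(\<Sum>j\<in>{..<n} - {m}. F \<bar>u - v j\<bar> + F (u + v j)) \<le> 2 * S"
  proof -
    have "(\<Sum>j\<in>{..<n} - {m}. F \<bar>u - v j\<bar>) = (\<Sum>j<min n m. F \<bar>u - v j\<bar>) + (\<Sum>j\<in>{m<..<n}. F \<bar>u - v j\<bar>)"
      unfolding split by (subst sum.union_disjoint) auto
    then show ?thesis using s1 s2 by (simp add: sum.distrib)
  qed
  then have "exp (\<Sum>j\<in>{..<n} - {m}. F \<bar>u - v j\<bar> + F (u + v j)) \<le> exp (2 * S)" by simp
  also have "exp (\<Sum>j\<in>{..<n} - {m}. F \<bar>u - v j\<bar> + F (u + v j))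
     = (\<Prod>j\<in>{..<n} - {m}. (cosh u + cosh (v j)) / \<bar>cosh u - cosh (v j)\<bar>)"
    using u vpos ne by (subst exp_sum) (auto intro!: prod.cong simp: cosh_ratio_eq_exp F_def less_imp_le)
  also have "exp (2 * S) = (exp (F (\<epsilon>/2)))\<^sup>2 * exp (pi\<^sup>2 / (2 * \<epsilon>))"
    by (simp add: S_def exp_add[symmetric] power2_eq_square)
  also have "exp (F (\<epsilon>/2)) = cosh (\<epsilon>/4) / sinh (\<epsilon>/4)"
    using exp_artanh_sech[of "\<epsilon>/2"] eps by (simp add: F_def)
  also have "(cosh (\<epsilon>/4) / sinh (\<epsilon>/4))\<^sup>2 * exp (pi\<^sup>2 / (2 * \<epsilon>)) \<le> (1 + 4 / \<epsilon>)\<^sup>2 * exp (pi\<^sup>2 / (2 * \<epsilon>))"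
    using coth_le[of "\<epsilon>/4"] eps by (intro mult_right_mono power_mono) auto
  finally show ?thesis using ne by blast
qed

text \<open>The sum is half the logarithm of the modulus at the origin of the product built in
  \<open>ex_dilated_blaschke\<close>. For \<psi> < pi / 2 the summand stays finite at u = 0, as the
  lower comparison requires.\<close>

lemma ex_sum_artanh_sech_ge:
  fixes \<psi> \<epsilon> :: real
  assumes "0 \<le> \<psi>" "\<psi> < pi / 2" "\<epsilon> > 0"
  shows "\<exists>n. (\<Sum>j<n. artanh (sin \<psi> / cosh ((real j + 1/2) * \<epsilon>))) \<ge> pi / 2 * \<psi> / \<epsilon> - artanh (sin \<psi>) - 1"
proof -
  have s: "0 \<le> sin \<psi>" "sin \<psi> < 1"
    using assms sin_ge_zero[of \<psi>] sin_monotone_2pi[of \<psi> "pi/2"] by auto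
  have l: "sin \<psi> < cosh x" for x :: real using s cosh_real_ge_1[of x] by linarith
  have nn: "0 \<le> artanh (sin \<psi> / cosh x)" for x :: real
    using s l[of x] artanh_mono_real[of 0 "sin \<psi> / cosh x"] by simp
  show ?thesis
    using ex_sum_ge_nn_integral_decreasing[of "\<lambda>u. artanh (sin \<psi> / cosh u)" \<epsilon> "pi/2*\<psi>"]
      nn_integral_artanh_sech[of \<psi>] assms nn s l by (auto intro: artanh_sech_antimono)
qed

section \<open>Moving a linear set outward\<close>

text \<open>Pushes \<open>P\<close> towards 1 so that all gaps close: the part of \<open>P\<close>
  beyond \<open>x\<close> has the length of the interval from \<open>outward P x\<close> to 1. The
  whole of \<open>P\<close> corresponds to the model interval from 1 - |P| to 1.\<close>

definition outward :: "real set \<Rightarrow> real \<Rightarrow> real" where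
  "outward P x = 1 - measure lborel (P \<inter> {x..1})"

context
  fixes P :: "real set"
  assumes P: "compact P" "P \<subseteq> {0<..1}"
begin

lemma outward_sets [measurable]: "P \<in> sets lborel"
  using P by (simp add: borel_compact)

lemma outward_fm: "P \<inter> {x..y} \<in> fmeasurable lborel"
  by (rule fmeasurableI2[of "{x..y}"]) (auto simp: fmeasurable_def emeasure_lborel_Icc_eq)

lemma outward_mono: "x \<le> y \<Longrightarrow> outward P x \<le> outward P y"
  unfolding outward_def by (intro diff_left_mono measure_mono_fmeasurable outward_fm) auto

lemma outward_split:
  assumes "x \<le> y" "y \<le> 1"
  shows "outward P y - outward P x \<le> measure lborel (P \<inter> {x..y})"
proof -
  have "measure lborel (P \<inter> {x..1}) \<le> measure lborel ((P \<inter> {x..y}) \<union> (P \<inter> {y..1}))"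
    using assms by (intro measure_mono_fmeasurable fmeasurable.Un outward_fm) auto
  also have "\<dots> \<le> measure lborel (P \<inter> {x..y}) + measure lborel (P \<inter> {y..1})"
    by (intro measure_Un_le) auto
  finally show ?thesis by (simp add: outward_def)
qed

lemma outward_lipschitz:
  assumes "x \<le> y" "y \<le> 1"
  shows "outward P y - outward P x \<le> y - x"
proof -
  have "measure lborel (P \<inter> {x..y}) \<le> measure lborel {x..y}"
    by (intro measure_mono_fmeasurable) (auto simp: fmeasurable_def emeasure_lborel_Icc_eq)
  then show ?thesis using outward_split[OF assms] assms by simp
qed

lemma outward_1: "outward P 1 = 1"
proof -
  have "measure lborel (P \<inter> {1..1}) \<le> measure lborel {1..1::real}"
    by (intro measure_mono_fmeasurable) (auto simp: fmeasurable_def emeasure_lborel_Icc_eq)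
  then show ?thesis by (simp add: outward_def measure_le_0_iff)
qed

lemma outward_ge: "x \<le> 1 \<Longrightarrow> x \<le> outward P x"
  using outward_lipschitz[of x 1] outward_1 by simp

lemma outward_le: "outward P x \<le> 1"
  by (simp add: outward_def)

lemma outward_0: "outward P 0 = 1 - measure lborel P"
proof -
  have "P \<inter> {0..1} = P" using P by auto
  then show ?thesis by (simp add: outward_def)
qed

text \<open>The ratio \<open>outward P x / x\<close> decreases, because \<open>outward P\<close> has
  slope at most 1 and lies above the diagonal. This is what makes the dilation attached to one point
  of \<open>P\<close> comparable with the shift at every other modulus.\<close>

lemma outward_ratio:
  assumes "0 \<le> x" "x \<le> y" "y \<le> 1"
  shows "outward P y * x \<le> outward P x * y"
proof -
  have "outward P y * x \<le> (outward P x + (y - x)) * x"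
    using outward_lipschitz[of x y] assms by (intro mult_right_mono) auto
  also have "\<dots> = outward P x * x + (y - x) * x" by (simp add: algebra_simps)
  also have "\<dots> \<le> outward P x * x + (y - x) * outward P x"
    using outward_ge[of x] assms by (intro add_left_mono mult_left_mono) auto
  finally show ?thesis by (simp add: algebra_simps)
qed

text \<open>A solution exists by continuity, and the last one lies in \<open>P\<close>: off the
  closed set \<open>P\<close> the function is locally constant, so a later solution would exist.
  \<open>T < 1\<close> leaves room to the right.\<close>

lemma outward_surj:
  assumes T: "outward P 0 \<le> T" "T < 1"
  shows "\<exists>t\<in>P. outward P t = T"
proof -
  have cont: "continuous_on {0..1} (outward P)"
  proof (rule continuous_onI)
    fix x e :: real assume "x \<in> {0..1}" "e > 0"
    have "dist (outward P y) (outward P x) \<le> e" if "y \<in> {0..1}" "dist y x < e" for y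
      using that \<open>x \<in> {0..1}\<close> outward_lipschitz[of x y] outward_lipschitz[of y x] outward_mono[of x y] outward_mono[of y x]
      by (cases "x \<le> y") (auto simp: dist_real_def)
    then show "\<exists>d>0. \<forall>x'\<in>{0..1}. dist x' x < d \<longrightarrow> dist (outward P x') (outward P x) \<le> e"
      using \<open>e > 0\<close> by blast
  qed
  define S where "S = {0..1} \<inter> outward P -` {T}"
  have "closed S" unfolding S_def by (rule continuous_closed_preimage[OF cont]) auto
  moreover have "bounded S" by (rule bounded_subset[of "{0..1}"]) (auto simp: S_def)
  ultimately have "compact S" by (simp add: compact_eq_bounded_closed)
  moreover have "S \<noteq> {}"
    using IVT'[of "outward P" 0 T 1] T outward_1 cont by (auto simp: S_def)
  ultimately obtain t where t: "t \<in> S" "\<And>s. s \<in> S \<Longrightarrow> s \<le> t"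
    using compact_attains_sup[of S] by blast
  have t01: "0 \<le> t" "t < 1" "outward P t = T"
    using t(1) outward_1 T by (auto simp: S_def order.strict_iff_order)
  have "t \<in> P"
  proof (rule ccontr)
    assume "t \<notin> P"
    then obtain e where e: "e > 0" "ball t e \<subseteq> - P"
      using P compact_imp_closed open_Compl open_contains_ball by (metis ComplI)
    define y where "y = min 1 (t + e / 2)"
    have y: "t < y" "y \<le> 1" using e t01 by (auto simp: y_def)
    have "P \<inter> {t..y} = {}" using e by (force simp: y_def dist_real_def subset_iff)
    then have "outward P y \<le> outward P t" using outward_split[of t y] y by simp
    then have "y \<in> S" using outward_mono[of t y] y t01 by (auto simp: S_def)
    then show False using t(2) y by force
  qed
  then show ?thesis using t01 by blast
qed

end

section \<open>Comparison of Blaschke factors by modulus\<close>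

lemma cmod_blaschke_identity:
  fixes w :: complex and \<tau> :: real
  shows "(cmod (1 - w * of_real \<tau>))\<^sup>2 = (cmod (w - of_real \<tau>))\<^sup>2 + (1 - (cmod w)\<^sup>2) * (1 - \<tau>\<^sup>2)"
  unfolding cmod_power2 by (simp add: algebra_simps power2_eq_square)

lemma blaschke_inverse_le:
  fixes w :: complex and \<tau> \<xi> :: real
  assumes tau: "0 < \<tau>" "\<tau> < 1" and xi: "0 \<le> \<xi>" "\<xi> \<le> 1"
    and ord: "cmod w \<le> \<xi> \<and> \<xi> < \<tau> \<or> \<tau> < \<xi> \<and> \<xi> \<le> cmod w"
  shows "cmod ((1 - w * of_real \<tau>) / (w - of_real \<tau>)) \<le> (1 - \<xi> * \<tau>) / \<bar>\<xi> - \<tau>\<bar>"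
proof -
  define p where "p = cmod w"
  have p: "p \<ge> 0" by (simp add: p_def)
  have dist: "\<bar>p - \<tau>\<bar> \<le> cmod (w - of_real \<tau>)"
    using norm_triangle_ineq3[of w "of_real \<tau>"] tau by (simp add: p_def)
  have ne: "p \<noteq> \<tau>" "\<xi> \<noteq> \<tau>" using ord by (auto simp: p_def)
  have t2: "1 - \<tau>\<^sup>2 > 0" using tau by (simp add: power_less_one_iff)
  have "\<xi> * \<tau> \<le> 1" using mult_mono[of \<xi> 1 \<tau> 1] tau xi by simp
  \<comment> \<open>This is the claim squared, after \<open>cmod_blaschke_identity\<close> has
    removed the common term and the factor 1 - \<tau>^2.\<close>
  have key: "(1 - p\<^sup>2) * (\<xi> - \<tau>)\<^sup>2 \<le> (1 - \<xi>\<^sup>2) * (cmod (w - of_real \<tau>))\<^sup>2"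
  proof (cases "p < 1")
    case False
    have "(1 - p\<^sup>2) * (\<xi> - \<tau>)\<^sup>2 \<le> 0" using False by (intro mult_nonpos_nonneg) auto
    also have "0 \<le> (1 - \<xi>\<^sup>2) * (cmod (w - of_real \<tau>))\<^sup>2" using xi by (simp add: power_le_one)
    finally show ?thesis .
  next
    case True
    have pt: "p * \<tau> \<le> 1" using True tau p mult_mono[of p 1 \<tau> 1] by simp
    have "\<bar>\<xi> - \<tau>\<bar> * (1 - p * \<tau>) \<le> \<bar>p - \<tau>\<bar> * (1 - \<xi> * \<tau>)"
    proof (cases "\<xi> < \<tau>")
      case True
      then have "p \<le> \<xi>" using ord by (auto simp: p_def)
      then have "0 \<le> (\<xi> - p) * (1 - \<tau>\<^sup>2)" using t2 by (intro mult_nonneg_nonneg) auto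
      then show ?thesis using True \<open>p \<le> \<xi>\<close> by (simp add: algebra_simps power2_eq_square)
    next
      case False
      then have "\<tau> < \<xi>" "\<xi> \<le> p" using ord by (auto simp: p_def)
      then have "0 \<le> (p - \<xi>) * (1 - \<tau>\<^sup>2)" using t2 by (intro mult_nonneg_nonneg) auto
      then show ?thesis using \<open>\<tau> < \<xi>\<close> \<open>\<xi> \<le> p\<close> by (simp add: algebra_simps power2_eq_square)
    qed
    then have "(\<bar>\<xi> - \<tau>\<bar> * (1 - p * \<tau>))\<^sup>2 \<le> (\<bar>p - \<tau>\<bar> * (1 - \<xi> * \<tau>))\<^sup>2"
      using pt by (intro power_mono) auto
    moreover have "(1 - p * \<tau>)\<^sup>2 = (p - \<tau>)\<^sup>2 + (1 - p\<^sup>2) * (1 - \<tau>\<^sup>2)"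
      "(1 - \<xi> * \<tau>)\<^sup>2 = (\<xi> - \<tau>)\<^sup>2 + (1 - \<xi>\<^sup>2) * (1 - \<tau>\<^sup>2)"
      by (simp_all add: algebra_simps power2_eq_square)
    ultimately have "(\<xi> - \<tau>)\<^sup>2 * ((p - \<tau>)\<^sup>2 + (1 - p\<^sup>2) * (1 - \<tau>\<^sup>2)) \<le> (p - \<tau>)\<^sup>2 * ((\<xi> - \<tau>)\<^sup>2 + (1 - \<xi>\<^sup>2) * (1 - \<tau>\<^sup>2))"
      by (simp add: power_mult_distrib)
    then have "((1 - p\<^sup>2) * (\<xi> - \<tau>)\<^sup>2) * (1 - \<tau>\<^sup>2) \<le> ((1 - \<xi>\<^sup>2) * (p - \<tau>)\<^sup>2) * (1 - \<tau>\<^sup>2)"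
      by (simp add: algebra_simps)
    then have "(1 - p\<^sup>2) * (\<xi> - \<tau>)\<^sup>2 \<le> (1 - \<xi>\<^sup>2) * (p - \<tau>)\<^sup>2" using t2 by simp
    also have "\<dots> \<le> (1 - \<xi>\<^sup>2) * (cmod (w - of_real \<tau>))\<^sup>2"
      using xi dist by (intro mult_left_mono) (auto simp: power_le_one abs_le_square_iff[symmetric])
    finally show ?thesis .
  qed
  have "(cmod (1 - w * of_real \<tau>) * \<bar>\<xi> - \<tau>\<bar>)\<^sup>2 = (cmod (w - of_real \<tau>))\<^sup>2 * (\<xi> - \<tau>)\<^sup>2 + (1 - p\<^sup>2) * (\<xi> - \<tau>)\<^sup>2 * (1 - \<tau>\<^sup>2)"
    unfolding power_mult_distrib cmod_blaschke_identity p_def by (simp add: algebra_simps)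
  also have "\<dots> \<le> (cmod (w - of_real \<tau>))\<^sup>2 * (\<xi> - \<tau>)\<^sup>2 + (1 - \<xi>\<^sup>2) * (cmod (w - of_real \<tau>))\<^sup>2 * (1 - \<tau>\<^sup>2)"
    using key t2 by (intro add_left_mono mult_right_mono) auto
  also have "\<dots> = ((1 - \<xi> * \<tau>) * cmod (w - of_real \<tau>))\<^sup>2"
    by (simp add: algebra_simps power2_eq_square)
  finally have "cmod (1 - w * of_real \<tau>) * \<bar>\<xi> - \<tau>\<bar> \<le> (1 - \<xi> * \<tau>) * cmod (w - of_real \<tau>)"
    by (rule power2_le_imp_le) (use \<open>\<xi> * \<tau> \<le> 1\<close> in auto)
  moreover have "cmod (w - of_real \<tau>) > 0" using dist ne by linarith
  ultimately show ?thesis using ne by (simp add: norm_divide divide_simps mult.commute)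
qed

section \<open>Dilated Blaschke products\<close>

text \<open>Each factor is a Blaschke factor with its own dilation at least 1,
  chosen so that the zeros move from their model position back into \<open>P\<close>. A dilation does not change the value at the
  origin, and at a point of modulus \<open>x\<close> it increases the hyperbolic distance to the zero
  beyond the one at \<open>outward P x\<close>.\<close>

lemma ex_dilated_blaschke:
  fixes P :: "real set" and \<epsilon> b :: real
  assumes P: "compact P" "P \<subseteq> {0<..1}" and b: "b = 1 - measure lborel P" and eps: "\<epsilon> > 0"
  defines "\<psi> \<equiv> arcsin ((1 - b\<^sup>2) / (1 + b\<^sup>2))"
  obtains Z :: "real set" and g :: "complex \<Rightarrow> complex" where
    "finite Z" "Z \<subseteq> P"
    "g holomorphic_on {z. \<forall>t\<in>Z. z \<noteq> of_real t \<and> z \<noteq> - of_real t}"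
    "\<And>z. g (- z) = g z"
    "\<And>z. cmod z = 1 \<Longrightarrow> cmod (g z) \<le> 1"
    "\<And>r z. \<lbrakk>0 < r; r \<le> 1; cmod z \<le> 1; \<forall>t\<in>Z. r \<le> cmod (z - of_real t) \<and> r \<le> cmod (z + of_real t)\<rbrakk>
       \<Longrightarrow> cmod (g z) \<le> 2 / r\<^sup>2 * ((1 + 4 / \<epsilon>)\<^sup>2 * exp (pi\<^sup>2 / (2 * \<epsilon>)))"
    "cmod (g 0) \<ge> exp (pi * \<psi> / \<epsilon> - (2 * artanh (sin \<psi>) + 2))"
proof (cases "measure lborel P = 0")
  \<comment> \<open>Here b = 1 and \<psi> = 0, so the empty product serves.\<close>
  case True
  have "1 * 1 \<le> (1 + 4 / \<epsilon>)\<^sup>2 * exp (pi\<^sup>2 / (2 * \<epsilon>))" 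
    using eps by (intro mult_mono one_le_power) auto
  moreover have "2 / r\<^sup>2 \<ge> 1" if "0 < r" "r \<le> 1" for r :: real
    using that power_le_one[of r 2] by (simp add: field_simps)
  ultimately have "1 * 1 \<le> 2 / r\<^sup>2 * ((1 + 4 / \<epsilon>)\<^sup>2 * exp (pi\<^sup>2 / (2 * \<epsilon>)))" if "0 < r" "r \<le> 1" for r
    using that by (intro mult_mono) auto
  then show ?thesis
    using that[of "{}" "\<lambda>_. 1"] True by (simp add: b \<psi>_def)
next
  case False
  have ne: "P \<noteq> {}" using False by auto
  obtain p0 where p0: "p0 \<in> P" "\<And>x. x \<in> P \<Longrightarrow> p0 \<le> x"
    using compact_attains_inf[OF P(1) ne] by blast
  note out = outward_mono[OF P] outward_ge[OF P] outward_le[OF P] outward_ratio[OF P]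
  have o0: "outward P 0 = b" using outward_0[OF P] b by simp
  \<comment> \<open>\<open>P\<close> misses an interval next to 0. This gives a < 1, so that artanh
    (sin \<psi>) is a genuine finite constant.\<close>
  have b0: "0 < b"
  proof -
    have "P \<inter> {0..1} = P \<inter> {p0..1}" using p0 P by auto
    then have "outward P p0 = b" using o0 by (simp add: outward_def)
    then show ?thesis using out(2)[of p0] p0 P by force
  qed
  have b1: "b < 1" using b False by (simp add: less_le)
  define a where "a = (1 - b\<^sup>2) / (1 + b\<^sup>2)"
  have b2: "0 < b\<^sup>2" "b\<^sup>2 < 1" using b0 b1 by (auto simp: power_less_one_iff)
  have b3: "0 < 1 + b\<^sup>2" using b2 by linarith
  have a: "0 < a" "a < 1" unfolding a_def using b2 b3 by (simp_all add: divide_less_eq)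
  have ab: "(1 - a) / (1 + a) = b\<^sup>2" 
  proof -
    have "1 - a = 2 * b\<^sup>2 / (1 + b\<^sup>2)" "1 + a = 2 / (1 + b\<^sup>2)"
      using b3 unfolding a_def by (auto simp: diff_divide_eq_iff add_divide_eq_iff)
    then show ?thesis using b3 by simp
  qed
  have psi: "\<psi> = arcsin a" "sin \<psi> = a" "0 \<le> \<psi>" "\<psi> < pi / 2"
    using a arcsin_less_mono[of a 1] arcsin_le_mono[of 0 a] by (auto simp: \<psi>_def a_def[symmetric])
  define v where "v = (\<lambda>j::nat. (real j + 1/2) * \<epsilon>)"
  define c where "c = (\<lambda>j. cosh (v j))"
  have c1: "1 \<le> c j" for j by (simp add: c_def cosh_real_ge_1)
  have v0: "0 \<le> v j" for j using eps by (simp add: v_def)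
  obtain n where n: "(\<Sum>j<n. artanh (a / c j)) \<ge> pi / 2 * \<psi> / \<epsilon> - artanh a - 1"
    using ex_sum_artanh_sech_ge[OF psi(3,4) eps] by (auto simp: psi(2) c_def v_def)
  \<comment> \<open>Inverting s = (1 - z^2) / (1 + z^2) at s = a / c j gives z^2 = \<tau> j. The
    model points \<open>T j\<close> lie between \<open>b\<close>, which corresponds to u = 0, and 1,
    which corresponds to u = infinity.\<close>
  define \<tau> where "\<tau> = (\<lambda>j. (c j - a) / (c j + a))"
  define T where "T = (\<lambda>j. sqrt (\<tau> j))"
  have frac_mono: "(x - a) / (x + a) \<le> (y - a) / (y + a)" if "1 \<le> x" "x \<le> y" for x y
  proof -
    have "(x - a) / (x + a) = 1 - 2 * a / (x + a)" "(y - a) / (y + a) = 1 - 2 * a / (y + a)"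
      using that a by (auto simp: field_simps)
    moreover have "2 * a / (y + a) \<le> 2 * a / (x + a)" using that a by (intro divide_left_mono mult_pos_pos) auto
    ultimately show ?thesis by simp
  qed
  have tau: "b\<^sup>2 \<le> \<tau> j" "\<tau> j < 1" "0 < \<tau> j" for j
    using frac_mono[of 1 "c j"] c1[of j] a ab by (auto simp: \<tau>_def add_pos_pos)
  have T: "b \<le> T j" "T j < 1" "0 < T j" "(T j)\<^sup>2 = \<tau> j" for j
    using tau[of j] b0 by (auto simp: T_def intro: real_le_rsqrt)
  have "\<forall>j. \<exists>t\<in>P. outward P t = T j"
    using outward_surj[OF P] T o0 by auto
  then obtain t where t: "\<And>j. t j \<in> P" "\<And>j. outward P (t j) = T j" by metis
  have t01: "0 < t j" "t j \<le> 1" for j using t(1)[of j] P by auto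
  \<comment> \<open>Replacing z by l j * z moves the model point \<open>T j\<close> to
    \<open>t j\<close>, a point of \<open>P\<close>. That l j >= 1 holds because
    \<open>outward P\<close> only moves points towards 1.\<close>
  define l where "l = (\<lambda>j. T j / t j)"
  have l1: "1 \<le> l j" for j using out(2)[of "t j"] t t01 by (simp add: l_def)
  have l2: "1 \<le> (l j)\<^sup>2" for j using l1 by (simp add: one_le_power)
  define w where "w = (\<lambda>j z. of_real ((l j)\<^sup>2) * z\<^sup>2 :: complex)"
  have w_den: "w j z - of_real (\<tau> j) = of_real ((l j)\<^sup>2) * ((z - of_real (t j)) * (z + of_real (t j)))" for j z
  proof -
    have "\<tau> j = (l j)\<^sup>2 * (t j)\<^sup>2" using t01(1)[of j] by (simp add: l_def power_divide T(4))
    then show ?thesis by (simp add: w_def algebra_simps power2_eq_square)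
  qed
  have w_norm: "cmod (w j z) = (l j)\<^sup>2 * (cmod z)\<^sup>2" for j z
    by (simp add: w_def norm_mult norm_power)
  \<comment> \<open>Inverted Blaschke factors: the zeros of the denominator at t j and - t j are
    poles of \<open>g\<close>. So \<open>g\<close> is large near its poles and at 0 while it stays
    below 1 on the circle.\<close>
  define fac where "fac = (\<lambda>j z. (1 - w j z * of_real (\<tau> j)) / (w j z - of_real (\<tau> j)))"
  define g where "g = (\<lambda>z. \<Prod>j<n. fac j z)"
  define Z where "Z = t ` {..<n}"
  \<comment> \<open>By \<open>outward_ratio\<close>, the dilated modulus l j * |z| lies farther from
    \<open>T j\<close> than \<open>outward P (cmod z)\<close> does, and on the same side of it. This
    is the order condition of \<open>blaschke_inverse_le\<close> after squaring.\<close>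
  have fac_out: "cmod (fac j z) \<le> (1 - (outward P (cmod z))\<^sup>2 * \<tau> j) / \<bar>(outward P (cmod z))\<^sup>2 - \<tau> j\<bar>"
    if z: "cmod z \<le> 1" and X: "outward P (cmod z) \<noteq> T j" for j z
  proof -
    define x where "x = cmod z"
    define X where "X = outward P x"
    have x: "0 \<le> x" "x \<le> 1" using z by (auto simp: x_def)
    have X01: "0 < X" "X \<le> 1" using out(1)[of 0 x] x o0 b0 out(3)[of x] by (auto simp: X_def)
    have "cmod (w j z) \<le> X\<^sup>2 \<and> X\<^sup>2 < \<tau> j \<or> \<tau> j < X\<^sup>2 \<and> X\<^sup>2 \<le> cmod (w j z)"
    proof (cases "X < T j")
      case True
      then have "x \<le> t j" using out(1)[of "t j" x] t(2)[of j] by (force simp: X_def)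
      then have "T j * x \<le> X * t j" using out(4)[of x "t j"] x t01 t(2) by (simp add: X_def)
      then have "l j * x \<le> X" using t01(1)[of j] by (simp add: l_def field_simps)
      then have "(l j * x)\<^sup>2 \<le> X\<^sup>2" using l1[of j] x by (intro power_mono) auto
      moreover have "X\<^sup>2 < (T j)\<^sup>2" using True X01 by (intro power_strict_mono) auto
      ultimately show ?thesis by (simp add: w_norm x_def[symmetric] power_mult_distrib T(4))
    next
      case False
      then have XT: "T j < X" using that(2) by (simp add: X_def x_def)
      then have "t j \<le> x" using out(1)[of x "t j"] t(2)[of j] by (force simp: X_def)
      then have "X * t j \<le> T j * x" using out(4)[of "t j" x] x t01(1)[of j] t(2) by (simp add: X_def)
      then have "X \<le> l j * x" using t01(1)[of j] by (simp add: l_def field_simps)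
      then have "X\<^sup>2 \<le> (l j * x)\<^sup>2" using X01 by (intro power_mono) auto
      moreover have "(T j)\<^sup>2 < X\<^sup>2" using XT T(3)[of j] by (intro power_strict_mono) auto
      ultimately show ?thesis by (simp add: w_norm x_def[symmetric] power_mult_distrib T(4))
    qed
    then show ?thesis
      unfolding fac_def X_def[unfolded x_def, symmetric]
      using tau[of j] X01 by (intro blaschke_inverse_le) (auto simp: power_le_one)
  qed
  show ?thesis
  proof (rule that[of Z g])
    show "finite Z" "Z \<subseteq> P" using t by (auto simp: Z_def)
    show "g holomorphic_on {z. \<forall>t\<in>Z. z \<noteq> of_real t \<and> z \<noteq> - of_real t}"
    proof -
      have "w j z - of_real (\<tau> j) \<noteq> 0" if "z \<in> {z. \<forall>t\<in>Z. z \<noteq> of_real t \<and> z \<noteq> - of_real t}" "j < n" for j z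
        unfolding w_den using that l2[of j] by (auto simp: Z_def add_eq_0_iff2)
      then show ?thesis
        unfolding g_def fac_def by (intro holomorphic_intros) (auto simp: w_def intro!: holomorphic_intros)
    qed
    show "g (- z) = g z" for z by (simp add: g_def fac_def w_def)
    show "cmod (g z) \<le> 1" if "cmod z = 1" for z
      unfolding g_def prod_norm[symmetric]
    proof (rule prod_le_1, intro conjI)
      fix j
      \<comment> \<open>On the unit circle |w| is the square of l j, hence at least 1, where an
        inverted Blaschke factor is at most 1.\<close>
      have "(1 - (cmod (w j z))\<^sup>2) * (1 - (\<tau> j)\<^sup>2) \<le> 0"
        using l1[of j] that tau[of j] by (intro mult_nonpos_nonneg) (auto simp: w_norm one_le_power power_le_one)
      then have "(cmod (1 - w j z * of_real (\<tau> j)))\<^sup>2 \<le> (cmod (w j z - of_real (\<tau> j)))\<^sup>2"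
        by (simp add: cmod_blaschke_identity)
      then have "cmod (1 - w j z * of_real (\<tau> j)) \<le> cmod (w j z - of_real (\<tau> j))"
        by (rule power2_le_imp_le) simp
      then show "cmod (fac j z) \<le> 1" by (simp add: fac_def norm_divide divide_le_eq_1)
    qed simp
    show "cmod (g z) \<le> 2 / r\<^sup>2 * ((1 + 4 / \<epsilon>)\<^sup>2 * exp (pi\<^sup>2 / (2 * \<epsilon>)))"
      if r: "0 < r" "r \<le> 1" and z: "cmod z \<le> 1"
        and dist: "\<forall>t\<in>Z. r \<le> cmod (z - of_real t) \<and> r \<le> cmod (z + of_real t)" for r z
    proof -
      define X where "X = outward P (cmod z)"
      define \<xi> where "\<xi> = X\<^sup>2"
      have X01: "b \<le> X" "X \<le> 1" using out(1)[of 0 "cmod z"] o0 out(3) by (auto simp: X_def)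
      have r2: "2 / r\<^sup>2 \<ge> 1" using r power_le_one[of r 2] by (simp add: field_simps)
      have one: "1 \<le> (1 + 4 / \<epsilon>)\<^sup>2 * exp (pi\<^sup>2 / (2 * \<epsilon>))"
        using eps mult_mono[of 1 "(1 + 4 / \<epsilon>)\<^sup>2" 1 "exp (pi\<^sup>2 / (2 * \<epsilon>))"] by (auto simp: one_le_power)
      show ?thesis
      proof (cases "X = 1")
        \<comment> \<open>This is the limit u = infinity, where the comparison value of each factor
          is (1 - \<tau> j) / (1 - \<tau> j) = 1.\<close>
        case True
        have "cmod (g z) \<le> 1"
          unfolding g_def prod_norm[symmetric]
        proof (rule prod_le_1, intro conjI)
          fix j
          show "cmod (fac j z) \<le> 1"
            using fac_out[OF z, of j] T(2)[of j] tau[of j] True by (simp add: X_def)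
        qed simp
        also have "1 \<le> 2 / r\<^sup>2 * ((1 + 4 / \<epsilon>)\<^sup>2 * exp (pi\<^sup>2 / (2 * \<epsilon>)))"
          using mult_mono[OF r2 one] r by simp
        finally show ?thesis .
      next
        case False
        have xi: "b\<^sup>2 \<le> \<xi>" "\<xi> < 1" using X01 False b0 by (auto simp: \<xi>_def power_less_one_iff intro: power_mono)
        \<comment> \<open>Chosen so that \<xi> arises from \<open>d\<close> as \<tau> j does from
          \<open>c j\<close>. The bound \<xi> >= b^2 becomes d >= 1, so d = cosh u for some
          \<open>u\<close>, and the comparison values become the ratios of
          \<open>prod_cosh_ratio_le\<close>.\<close>
        define d where "d = a * (1 + \<xi>) / (1 - \<xi>)"
        have d_xi: "\<xi> = (d - a) / (d + a)"
        proof -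
          have "d - a = 2 * a * \<xi> / (1 - \<xi>)" "d + a = 2 * a / (1 - \<xi>)" using xi by (simp_all add: d_def field_simps)
          then show ?thesis using a xi by simp
        qed
        have d1: "1 \<le> d"
        proof -
          have "1 - b\<^sup>2 \<ge> 1 - \<xi>" "1 + b\<^sup>2 \<le> 1 + \<xi>" using xi by auto
          then have "(1 - \<xi>) * (1 + b\<^sup>2) \<le> (1 - b\<^sup>2) * (1 + \<xi>)" using b2 xi by (intro mult_mono) auto
          moreover have "d = ((1 - b\<^sup>2) * (1 + \<xi>)) / ((1 - \<xi>) * (1 + b\<^sup>2))"
            by (simp add: d_def a_def mult.commute)
          moreover have "0 < (1 - \<xi>) * (1 + b\<^sup>2)" using xi b3 by simp
          ultimately show ?thesis by (simp only: le_divide_eq_1_pos)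
        qed
        define u where "u = arcosh d"
        have u: "0 \<le> u" "cosh u = d" using d1 by (auto simp: u_def)
        obtain m where m: "\<And>j. j \<noteq> m \<Longrightarrow> u \<noteq> v j"
          "(\<Prod>j\<in>{..<n} - {m}. (cosh u + cosh (v j)) / \<bar>cosh u - cosh (v j)\<bar>) \<le> (1 + 4 / \<epsilon>)\<^sup>2 * exp (pi\<^sup>2 / (2 * \<epsilon>))"
          using prod_cosh_ratio_le[OF eps u(1), of n] by (auto simp: v_def)
        have fac1: "cmod (fac j z) \<le> (cosh u + cosh (v j)) / \<bar>cosh u - cosh (v j)\<bar>" if "j \<noteq> m" for j
        proof -
          have dc: "d \<noteq> c j" using m(1)[OF that] u v0[of j] by (auto simp: c_def cosh_real_eq_iff)
          have pos: "d + a > 0" "c j + a > 0" using d1 c1[of j] a by auto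
          have 1: "1 - \<xi> * \<tau> j = 2 * a * (d + c j) / ((d + a) * (c j + a))"
          proof -
            have "\<xi> * \<tau> j = ((d - a) * (c j - a)) / ((d + a) * (c j + a))" by (simp add: d_xi \<tau>_def)
            moreover have "1 = ((d + a) * (c j + a)) / ((d + a) * (c j + a))" using pos by simp
            ultimately have "1 - \<xi> * \<tau> j = ((d + a) * (c j + a) - (d - a) * (c j - a)) / ((d + a) * (c j + a))"
              by (simp only: diff_divide_distrib)
            then show ?thesis by (simp add: algebra_simps)
          qed
          have 2: "\<xi> - \<tau> j = 2 * a * (d - c j) / ((d + a) * (c j + a))"
            using pos by (simp add: d_xi \<tau>_def diff_frac_eq) (simp add: algebra_simps)
          have "X \<noteq> T j" using 2 dc a pos T(4)[of j] by (auto simp: \<xi>_def)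
          then have "cmod (fac j z) \<le> (1 - \<xi> * \<tau> j) / \<bar>\<xi> - \<tau> j\<bar>"
            using fac_out[OF z, of j] by (simp add: X_def \<xi>_def)
          also have "\<dots> = (d + c j) / \<bar>d - c j\<bar>"
            unfolding 1 2 using pos a dc by (simp add: abs_mult)
          finally show ?thesis using u by (simp add: c_def)
        qed
        \<comment> \<open>The one factor left out of the product estimate is bounded crudely by the
          distance \<open>r\<close> from its poles; the dilation cancels.\<close>
        have fac2: "cmod (fac m z) \<le> 2 / r\<^sup>2" if "m < n"
        proof -
          have tm: "t m \<in> Z" using that by (simp add: Z_def)
          have num: "cmod (1 - w m z * of_real (\<tau> m)) \<le> 2 * (l m)\<^sup>2"
          proof -
            have "cmod (1 - w m z * of_real (\<tau> m)) \<le> 1 + cmod (w m z) * \<tau> m"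
              using norm_triangle_ineq4[of 1 "w m z * of_real (\<tau> m)"] tau(3)[of m] by (simp add: norm_mult)
            also have "\<dots> \<le> 1 + (l m)\<^sup>2 * 1 * 1"
              unfolding w_norm using z tau[of m] by (intro add_left_mono mult_mono) (auto simp: power_le_one)
            finally show ?thesis using l2[of m] by simp
          qed
          have "(l m)\<^sup>2 * (r * r) \<le> cmod (w m z - of_real (\<tau> m))"
            unfolding w_den norm_mult using dist tm r by (intro mult_mono) (auto simp: norm_power)
          then have "cmod (fac m z) \<le> 2 * (l m)\<^sup>2 / ((l m)\<^sup>2 * (r * r))"
            unfolding fac_def norm_divide using num r l1[of m] by (intro frac_le) auto
          also have "\<dots> = 2 / r\<^sup>2" using l2[of m] by (auto simp: power2_eq_square)
          finally show ?thesis .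
        qed
        have rest: "(\<Prod>j\<in>{..<n} - {m}. cmod (fac j z)) \<le> (1 + 4 / \<epsilon>)\<^sup>2 * exp (pi\<^sup>2 / (2 * \<epsilon>))"
          using m(2) by (intro order_trans[OF prod_mono m(2)]) (auto intro: fac1)
        have "cmod (g z) = (\<Prod>j<n. cmod (fac j z))" by (simp add: g_def prod_norm)
        also have "\<dots> \<le> 2 / r\<^sup>2 * (\<Prod>j\<in>{..<n} - {m}. cmod (fac j z))"
        proof (cases "m < n")
          case True
          then have "(\<Prod>j<n. cmod (fac j z)) = cmod (fac m z) * (\<Prod>j\<in>{..<n} - {m}. cmod (fac j z))"
            by (intro prod.remove) auto
          then show ?thesis using mult_right_mono[OF fac2[OF True], of "\<Prod>j\<in>{..<n} - {m}. cmod (fac j z)"] by (simp add: prod_nonneg)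
        next
          case False
          then have "{..<n} - {m} = {..<n}" by auto
          then show ?thesis using mult_right_mono[OF r2, of "\<Prod>j<n. cmod (fac j z)"] by (simp add: prod_nonneg)
        qed
        also have "\<dots> \<le> 2 / r\<^sup>2 * ((1 + 4 / \<epsilon>)\<^sup>2 * exp (pi\<^sup>2 / (2 * \<epsilon>)))"
          using rest by (intro mult_left_mono) auto
        finally show ?thesis .
      qed
    qed
    show "exp (pi * \<psi> / \<epsilon> - (2 * artanh (sin \<psi>) + 2)) \<le> cmod (g 0)"
    proof -
      have "cmod (fac j 0) = exp (2 * artanh (a / c j))" for j
      proof -
        have "(1 + a / c j) / (1 - a / c j) = (c j + a) / (c j - a)"
        proof -
          have "1 + a / c j = (c j + a) / c j" "1 - a / c j = (c j - a) / c j" using c1[of j] by (auto simp: field_simps)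
          then show ?thesis using c1[of j] by simp
        qed
        moreover have "(c j + a) / (c j - a) > 0" using a c1[of j] by simp
        ultimately have "exp (2 * artanh (a / c j)) = (c j + a) / (c j - a)" by (simp add: artanh_def)
        also have "\<dots> = 1 / \<tau> j" by (simp add: \<tau>_def)
        finally show ?thesis using tau(3)[of j] by (simp add: fac_def w_def norm_divide)
      qed
      then have "cmod (g 0) = exp (\<Sum>j<n. 2 * artanh (a / c j))"
        by (simp add: g_def prod_norm[symmetric] exp_sum)
      moreover have "pi * \<psi> / \<epsilon> - (2 * artanh (sin \<psi>) + 2) \<le> (\<Sum>j<n. 2 * artanh (a / c j))"
        using n by (simp add: sum_distrib_left[symmetric] psi(2))
      ultimately show ?thesis by simp
    qed
  qed
qed

section \<open>The two-constants theorem for linear sets\<close>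

text \<open>The sum arctan (s - e) + arctan (s + e) decreases in e >= 0 when s >= 0, as its
  derivative shows.\<close>

lemma arctan_midpoint:
  fixes x y :: real
  assumes "0 \<le> x" "0 \<le> y"
  shows "arctan x + arctan y \<le> 2 * arctan ((x + y) / 2)"
proof -
  have main: "arctan x + arctan y \<le> 2 * arctan ((x + y) / 2)" if xy: "0 \<le> x" "x \<le> y" for x y :: real
  proof -
    define s d where "s = (x + y) / 2" and "d = (y - x) / 2"
    have sd: "0 \<le> s" "0 \<le> d" using xy by (auto simp: s_def d_def)
    have "arctan (s - d) + arctan (s + d) \<le> arctan (s - 0) + arctan (s + 0)"
    proof (rule DERIV_nonpos_imp_nonincreasing[OF sd(2)])
      fix e assume e: "0 \<le> e" "e \<le> d"
      have sq: "1 + (s + e)\<^sup>2 > 0" "1 + (s - e)\<^sup>2 > 0" by (simp_all add: add_pos_nonneg)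
      have "((\<lambda>e. arctan (s - e) + arctan (s + e)) has_real_derivative
          1 / (1 + (s + e)\<^sup>2) - 1 / (1 + (s - e)\<^sup>2)) (at e)"
        using sq by (auto intro!: derivative_eq_intros simp: field_simps)
      moreover have "1 / (1 + (s + e)\<^sup>2) \<le> 1 / (1 + (s - e)\<^sup>2)"
      proof (rule divide_left_mono)
        have "0 \<le> s * e" using sd e by simp
        then show "1 + (s - e)\<^sup>2 \<le> 1 + (s + e)\<^sup>2" by (simp add: power2_sum power2_diff mult_ac)
      qed (use sq in auto)
      ultimately show "\<exists>y. ((\<lambda>e. arctan (s - e) + arctan (s + e)) has_real_derivative y) (at e) \<and> y \<le> 0"
        by (intro exI conjI) auto
    qed
    moreover have "s - d = x" "s + d = y" by (auto simp: s_def d_def field_simps)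
    ultimately show ?thesis by (simp add: s_def)
  qed
  show ?thesis using main[of x y] main[of y x] assms by (cases "x \<le> y") (auto simp: add.commute)
qed

text \<open>Both sides have sine cos (2 * arctan b). In this form the angle \<psi> is visibly convex
  in b >= 0, and \<open>h\<close> becomes 1 - 4 * arctan \<delta> / pi.\<close>

lemma arcsin_eq_arctan:
  fixes b :: real
  assumes "0 \<le> b"
  shows "arcsin ((1 - b\<^sup>2) / (1 + b\<^sup>2)) = pi / 2 - 2 * arctan b"
proof -
  have b: "1 + b\<^sup>2 > 0" by (simp add: add_pos_nonneg)
  have "sin (pi / 2 - 2 * arctan b) = cos (2 * arctan b)" by (simp add: sin_diff)
  also have "\<dots> = (1 - b\<^sup>2) / (1 + b\<^sup>2)"
    using b by (simp add: cos_double cos_arctan sin_arctan power_divide diff_divide_distrib)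
  finally have "(1 - b\<^sup>2) / (1 + b\<^sup>2) = sin (pi / 2 - 2 * arctan b)" by simp
  moreover have "0 \<le> arctan b" "arctan b < pi / 2" using assms arctan_ubound by auto
  ultimately show ?thesis by (simp add: arcsin_sin)
qed

lemma measure_reflect_real:
  fixes S :: "real set"
  assumes "S \<in> sets borel"
  shows "measure lborel (uminus ` S) = measure lborel S"
proof -
  have "uminus ` S = uminus -` S" by force
  then have "measure lborel (uminus ` S) = measure (distr lborel borel uminus) S"
    using assms by (simp add: measure_distr)
  then show ?thesis by (simp add: lborel_distr_uminus)
qed

text \<open>The argument uses just that the frontier of the open region lies on the unit circle or
  on hole boundaries, so holes may overlap one another and the circle.\<close>

lemma maximum_modulus_holes:
  fixes F :: "complex \<Rightarrow> complex" and Z :: "real set" and r B :: real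
  defines "C \<equiv> {z. cmod z \<le> 1 \<and> (\<forall>t\<in>Z. r \<le> cmod (z - of_real t) \<and> r \<le> cmod (z + of_real t))}"
  assumes Z: "finite Z" and cont: "continuous_on C F"
    and hol: "F holomorphic_on {z. cmod z < 1 \<and> (\<forall>t\<in>Z. r < cmod (z - of_real t) \<and> r < cmod (z + of_real t))}"
    and circle: "\<And>z. z \<in> C \<Longrightarrow> cmod z = 1 \<Longrightarrow> cmod (F z) \<le> B"
    and hole: "\<And>z t. z \<in> C \<Longrightarrow> t \<in> Z \<Longrightarrow> cmod (z - of_real t) = r \<or> cmod (z + of_real t) = r \<Longrightarrow> cmod (F z) \<le> B"
    and z: "z \<in> C"
  shows "cmod (F z) \<le> B"
proof -
  define S where "S = {z. cmod z < 1 \<and> (\<forall>t\<in>Z. r < cmod (z - of_real t) \<and> r < cmod (z + of_real t))}"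
  have bdry: "cmod (F z) \<le> B" if "z \<in> C" "z \<notin> S" for z
    using that circle[of z] hole[of z] unfolding S_def C_def by force
  show ?thesis
  proof (cases "z \<in> S")
    case False
    then show ?thesis using bdry z by blast
  next
    case True
    have "S = ball 0 1 \<inter> (\<Inter>t\<in>Z. {z. r < cmod (z - of_real t)} \<inter> {z. r < cmod (z + of_real t)})"
      by (auto simp: S_def)
    moreover have "open (ball 0 1 \<inter> (\<Inter>t\<in>Z. {z. r < cmod (z - of_real t)} \<inter> {z. r < cmod (z + of_real t)}))"
      using Z by (intro open_Int open_INT ballI open_ball open_Collect_less continuous_intros) auto
    ultimately have op: "open S" by simp
    have "C = cball 0 1 \<inter> (\<Inter>t\<in>Z. {z. r \<le> cmod (z - of_real t)} \<inter> {z. r \<le> cmod (z + of_real t)})"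
      by (auto simp: C_def)
    moreover have "closed (cball 0 1 \<inter> (\<Inter>t\<in>Z. {z. r \<le> cmod (z - of_real t)} \<inter> {z. r \<le> cmod (z + of_real t)}))"
      by (intro closed_Int closed_INT ballI closed_cball closed_Collect_le continuous_intros)
    ultimately have "closed C" by simp
    then have cl: "closure S \<subseteq> C" by (intro closure_minimal) (auto simp: S_def C_def less_imp_le)
    show ?thesis
    proof (rule maximum_modulus_frontier[of F S])
      show "F holomorphic_on interior S" using hol op by (simp add: interior_open S_def)
      show "continuous_on (closure S) F" using cont cl by (rule continuous_on_subset)
      show "bounded S" by (rule bounded_subset[of "ball 0 1"]) (auto simp: S_def)
      show "cmod (F z) \<le> B" if "z \<in> frontier S" for z
        using that cl op bdry by (auto simp: frontier_def interior_open)
    qed (rule True)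
  qed
qed

text \<open>Write \<rho> = (1 + x)^3. Bernoulli's inequality then bounds \<rho>^N below by the cubic
  (1 + N * x)^3, which beats the quadratic.\<close>

lemma not_power_le_polynomial:
  fixes \<rho> C E :: real
  assumes "\<rho> > 1" "C > 0" "E \<ge> 0"
  shows "\<exists>N\<ge>1. \<rho> ^ N > C * (1 + E * real N)\<^sup>2"
proof -
  define x where "x = root 3 \<rho> - 1"
  have x: "x > 0" "(1 + x) ^ 3 = \<rho>" using assms by (auto simp: x_def odd_real_root_pow)
  define D where "D = 1 + E / x"
  have D: "D \<ge> 1" using assms x by (simp add: D_def)
  obtain N where N: "real N > C * D\<^sup>2 / x" using reals_Archimedean2 by blast
  have "C * D\<^sup>2 / x > 0" using assms x D by (intro divide_pos_pos mult_pos_pos) auto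
  then have N1: "N \<ge> 1" using N by (cases N) auto
  define y where "y = 1 + real N * x"
  have y: "y > C * D\<^sup>2" "y > 0" using N x by (auto simp: y_def field_simps intro: add_pos_nonneg)
  have "1 + E * real N \<le> D * y"
  proof -
    have "E * real N = (E / x) * (real N * x)" using x by simp
    also have "\<dots> \<le> (E / x) * y" using assms x by (intro mult_left_mono) (auto simp: y_def)
    finally show ?thesis using x by (simp add: D_def y_def algebra_simps)
  qed
  then have "C * (1 + E * real N)\<^sup>2 \<le> C * (D * y)\<^sup>2"
    using assms by (intro mult_left_mono power_mono) auto
  also have "\<dots> = (C * D\<^sup>2) * y\<^sup>2" by (simp add: power_mult_distrib)
  also have "\<dots> < y * y\<^sup>2" using y by (intro mult_strict_right_mono) auto
  also have "\<dots> = y ^ 3" by (simp add: power2_eq_square power3_eq_cube)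
  also have "\<dots> \<le> ((1 + x) ^ N) ^ 3"
    using Bernoulli_inequality[of x N] x y by (intro power_mono) (auto simp: y_def)
  also have "\<dots> = \<rho> ^ N" by (simp add: x(2)[symmetric] power_mult[symmetric] mult.commute)
  finally show ?thesis using N1 by blast
qed

text \<open>With \<open>K\<close> the set where \<open>\<bar>f\<bar> \<le> M\<close>, the product \<open>f z * f (- z)\<close> is compared with the symmetric
  problems for \<open>P = K \<union> - K\<close> and \<open>Q = K \<inter> - K\<close>, whose total length is that of \<open>K\<close>. On \<open>Q\<close> both
  factors are small; on the rest of \<open>P\<close> one factor is small and the other is controlled by the
  bound already obtained from \<open>Q\<close>.\<close>

lemma two_constants_power_bound:
  fixes f :: "complex \<Rightarrow> complex" and M q r :: real and K :: "real set" and N :: nat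
  assumes cont: "continuous_on (cball 0 1) f" and hol: "f holomorphic_on ball 0 1"
    and f1: "\<And>z. cmod z \<le> 1 \<Longrightarrow> cmod (f z) \<le> 1"
    and M: "0 < M" "M < 1" and q: "M \<le> q" and r: "0 < r" "r \<le> 1"
    and K: "compact K" "K \<subseteq> {-1..1}"
    and near: "\<And>z x. cmod z \<le> 1 \<Longrightarrow> x \<in> K \<Longrightarrow> cmod (z - of_real x) \<le> r \<Longrightarrow> cmod (f z) \<le> q"
    and f0: "q < cmod (f 0)"
    and N: "N \<ge> 1" and delta: "2 - 2 * \<delta> \<le> measure lborel K" "0 < \<delta>" "\<delta> < 1"
  defines "P \<equiv> (K \<union> uminus ` K) \<inter> {0..1}" and "Q \<equiv> (K \<inter> uminus ` K) \<inter> {0..1}"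
  defines "bP \<equiv> 1 - measure lborel P" and "bQ \<equiv> 1 - measure lborel Q"
  defines "\<psi> \<equiv> \<lambda>b. arcsin ((1 - b\<^sup>2) / (1 + b\<^sup>2))"
  defines "c \<equiv> (2 * artanh (sin (\<psi> bP)) + 2) + (2 * artanh (sin (\<psi> bQ)) + 2)"
  shows "cmod (f 0) ^ (2 * N) * (M powr (- 2 * (2 / pi * \<psi> \<delta>) * N)) \<le>
    exp c * (2 / r\<^sup>2 * (1 + 8 * (- ln M) / pi\<^sup>2 * N)\<^sup>2 * (q / M) ^ N)\<^sup>2"
proof -
  \<comment> \<open>Since |f 0| > q, the origin is not in \<open>K\<close>; this places
    \<open>P\<close> and \<open>Q\<close> inside the half-open interval that
    \<open>ex_dilated_blaschke\<close> asks for.\<close>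
  have K0: "x \<noteq> 0" if "x \<in> K" for x
    using near[of 0 x] f0 r that by force
  have K': "compact (uminus ` K)" using K by (intro compact_continuous_image continuous_intros)
  have P: "compact P" "P \<subseteq> {0<..1}" using K K' K0 by (auto simp: P_def less_le intro!: compact_Int compact_Un)
  have Q: "compact Q" "Q \<subseteq> {0<..1}" using K K' K0 by (auto simp: Q_def less_le intro!: compact_Int)
  define L where "L = - ln M"
  define k where "k = N * L"
  \<comment> \<open>Makes exp (pi^2 / (2 * \<epsilon>)) equal to (1 / M)^N, so that the size of the
    products on hole boundaries offsets the smallness of f^N there.\<close>
  define \<epsilon> where "\<epsilon> = pi\<^sup>2 / (2 * k)"
  have L: "L > 0" using M by (simp add: L_def)
  have k: "k > 0" using L N by (simp add: k_def)
  have eps: "\<epsilon> > 0" using k by (simp add: \<epsilon>_def)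
  have ek: "exp (pi\<^sup>2 / (2 * \<epsilon>)) = (1 / M) ^ N"
  proof -
    have "pi\<^sup>2 / (2 * \<epsilon>) = N * L" using k by (simp add: \<epsilon>_def k_def)
    also have "exp (N * L) = exp L ^ N" by (rule exp_of_nat_mult)
    also have "exp L = 1 / M" using M by (simp add: L_def exp_minus inverse_eq_divide)
    finally show ?thesis .
  qed
  define D where "D = 2 / r\<^sup>2 * (1 + 4 / \<epsilon>)\<^sup>2"
  have D1: "D \<ge> 1"
  proof -
    have "2 / r\<^sup>2 \<ge> 1" using r power_le_one[of r 2] by (simp add: field_simps)
    then show ?thesis using mult_mono[of 1 "2 / r\<^sup>2" 1 "(1 + 4 / \<epsilon>)\<^sup>2"] eps by (simp add: D_def one_le_power)
  qed
  define A where "A = D * (q / M) ^ N"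
  have A1: "A \<ge> 1" using mult_mono[of 1 D 1 "(q/M)^N"] D1 q M by (simp add: A_def one_le_power)
  have \<psi>_eq: "arcsin ((1 - b\<^sup>2) / (1 + b\<^sup>2)) = \<psi> b" for b by (simp add: \<psi>_def)
  obtain ZP gP where ZP: "finite ZP" "ZP \<subseteq> P"
    and gP: "gP holomorphic_on {z. \<forall>t\<in>ZP. z \<noteq> of_real t \<and> z \<noteq> - of_real t}" "\<And>z. gP (- z) = gP z"
      "\<And>z. cmod z = 1 \<Longrightarrow> cmod (gP z) \<le> 1"
    and gP_le: "\<And>r z. \<lbrakk>0 < r; r \<le> 1; cmod z \<le> 1; \<forall>t\<in>ZP. r \<le> cmod (z - of_real t) \<and> r \<le> cmod (z + of_real t)\<rbrakk>
       \<Longrightarrow> cmod (gP z) \<le> 2 / r\<^sup>2 * ((1 + 4 / \<epsilon>)\<^sup>2 * exp (pi\<^sup>2 / (2 * \<epsilon>)))"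
    and gP0: "cmod (gP 0) \<ge> exp (pi * \<psi> bP / \<epsilon> - (2 * artanh (sin (\<psi> bP)) + 2))"
    by (rule ex_dilated_blaschke[OF P bP_def[THEN meta_eq_to_obj_eq] eps, unfolded \<psi>_eq], rule that, assumption+)
  obtain ZQ gQ where ZQ: "finite ZQ" "ZQ \<subseteq> Q"
    and gQ: "gQ holomorphic_on {z. \<forall>t\<in>ZQ. z \<noteq> of_real t \<and> z \<noteq> - of_real t}" "\<And>z. gQ (- z) = gQ z"
      "\<And>z. cmod z = 1 \<Longrightarrow> cmod (gQ z) \<le> 1"
    and gQ_le: "\<And>r z. \<lbrakk>0 < r; r \<le> 1; cmod z \<le> 1; \<forall>t\<in>ZQ. r \<le> cmod (z - of_real t) \<and> r \<le> cmod (z + of_real t)\<rbrakk>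
       \<Longrightarrow> cmod (gQ z) \<le> 2 / r\<^sup>2 * ((1 + 4 / \<epsilon>)\<^sup>2 * exp (pi\<^sup>2 / (2 * \<epsilon>)))"
    and gQ0: "cmod (gQ 0) \<ge> exp (pi * \<psi> bQ / \<epsilon> - (2 * artanh (sin (\<psi> bQ)) + 2))"
    by (rule ex_dilated_blaschke[OF Q bQ_def[THEN meta_eq_to_obj_eq] eps, unfolded \<psi>_eq], rule that, assumption+)
  define off where "off = (\<lambda>Z z. cmod z \<le> 1 \<and> (\<forall>t\<in>Z. r \<le> cmod (z - of_real t) \<and> r \<le> cmod (z + of_real t)))"
  have off_minus: "off Z (- z)" if "off Z z" for Z z
  proof -
    have "cmod (- z - of_real t) = cmod (z + of_real t)" "cmod (- z + of_real t) = cmod (z - of_real t)" for t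
      using norm_minus_cancel[of "z + of_real t"] norm_minus_commute[of z "of_real t"] by (simp_all add: algebra_simps)
    then show ?thesis using that by (auto simp: off_def)
  qed
  have small: "cmod (f z ^ N * g) \<le> A" if "cmod (f z) \<le> q" "cmod g \<le> D * (1 / M) ^ N" for z g
  proof -
    have "cmod (f z ^ N * g) \<le> q ^ N * (D * (1 / M) ^ N)"
      unfolding norm_mult norm_power using that M q by (intro mult_mono power_mono) auto
    then show ?thesis by (simp add: A_def power_divide power_mult_distrib mult_ac)
  qed
  have gP_D: "cmod (gP z) \<le> D * (1 / M) ^ N" if "off ZP z" for z
    using gP_le[of r z] r that ek by (simp add: off_def D_def mult.assoc)
  have gQ_D: "cmod (gQ z) \<le> D * (1 / M) ^ N" if "off ZQ z" for z
    using gQ_le[of r z] r that ek by (simp add: off_def D_def mult.assoc)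
  have K_near: "cmod (f z) \<le> q" if "cmod z \<le> 1" "t \<in> K" "cmod (z - of_real t) = r" for z t
    using near that by simp
  have K_near': "cmod (f z) \<le> q" if "cmod z \<le> 1" "t \<in> uminus ` K" "cmod (z + of_real t) = r" for z t
    using near[of z "- t"] that by auto
  have cont_g: "continuous_on {z. off Z z} g"
    if "g holomorphic_on {z. \<forall>t\<in>Z. z \<noteq> of_real t \<and> z \<noteq> - of_real t}" for g :: "complex \<Rightarrow> complex" and Z
    by (rule continuous_on_subset[OF holomorphic_on_imp_continuous_on[OF that]]) (use r in \<open>force simp: off_def\<close>)
  have hol_g: "g holomorphic_on {z. cmod z < 1 \<and> (\<forall>t\<in>Z'. r < cmod (z - of_real t) \<and> r < cmod (z + of_real t))}"
    if "g holomorphic_on {z. \<forall>t\<in>Z. z \<noteq> of_real t \<and> z \<noteq> - of_real t}" "Z \<subseteq> Z'" for g :: "complex \<Rightarrow> complex" and Z Z'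
    by (rule holomorphic_on_subset[OF that(1)]) (use r that(2) in force)
  have hol_f: "f holomorphic_on {z. cmod z < 1 \<and> R z}" for R
    by (rule holomorphic_on_subset[OF hol]) auto
  have hol_f': "(\<lambda>z. f (- z)) holomorphic_on {z. cmod z < 1 \<and> R z}" for R
  proof -
    have "uminus holomorphic_on {z::complex. cmod z < 1 \<and> R z}"
      using holomorphic_on_minus[OF holomorphic_on_ident] by simp
    then show ?thesis by (rule holomorphic_on_compose_gen[OF _ hol, unfolded o_def]) auto
  qed
  have cont_f: "continuous_on {z. off Z z} f" for Z
    by (rule continuous_on_subset[OF cont]) (auto simp: off_def)
  have cont_f': "continuous_on {z. off Z z} (\<lambda>z. f (- z))" for Z
    by (rule continuous_on_compose2[OF cont_f[of Z]]) (auto intro!: continuous_intros off_minus)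
  \<comment> \<open>For a pole t in \<open>Q\<close> both t and - t belong to \<open>K\<close>, so
    \<open>f\<close> is at most \<open>q\<close> on both hole boundaries. The resulting bound holds
    throughout the disc off the holes and is reused below at the poles in \<open>P\<close>.\<close>
  have step1: "cmod (f z ^ N * gQ z) \<le> A" if z: "off ZQ z" for z
  proof (rule maximum_modulus_holes[of ZQ r "\<lambda>z. f z ^ N * gQ z"])
    show "continuous_on {z. cmod z \<le> 1 \<and> (\<forall>t\<in>ZQ. r \<le> cmod (z - of_real t) \<and> r \<le> cmod (z + of_real t))} (\<lambda>z. f z ^ N * gQ z)"
      using cont_f[of ZQ] cont_g[OF gQ(1)] by (auto simp: off_def intro!: continuous_intros)
    show "(\<lambda>z. f z ^ N * gQ z) holomorphic_on {z. cmod z < 1 \<and> (\<forall>t\<in>ZQ. r < cmod (z - of_real t) \<and> r < cmod (z + of_real t))}"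
      by (intro holomorphic_intros hol_f hol_g[OF gQ(1)]) auto
    show "cmod (f z ^ N * gQ z) \<le> A" if "cmod z = 1" for z
    proof -
      have "cmod (f z ^ N * gQ z) \<le> 1 ^ N * 1"
        unfolding norm_mult norm_power using that f1 gQ(3) by (intro mult_mono power_mono) auto
      then show ?thesis using A1 by simp
    qed
    show "cmod (f z ^ N * gQ z) \<le> A"
      if "z \<in> {z. cmod z \<le> 1 \<and> (\<forall>t\<in>ZQ. r \<le> cmod (z - of_real t) \<and> r \<le> cmod (z + of_real t))}" "t \<in> ZQ"
        "cmod (z - of_real t) = r \<or> cmod (z + of_real t) = r" for z t
    proof (rule small)
      show "cmod (f z) \<le> q" using that ZQ(2) K_near[of z t] K_near'[of z t] by (auto simp: Q_def)
      show "cmod (gQ z) \<le> D * (1 / M) ^ N" using that by (intro gQ_D) (auto simp: off_def)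
    qed
  qed (use z ZQ in \<open>auto simp: off_def\<close>)
  define F where "F = (\<lambda>z. (f z ^ N * f (- z) ^ N) * (gP z * gQ z))"
  have offU: "off ZP z" "off ZQ z" if "off (ZP \<union> ZQ) z" for z using that by (auto simp: off_def)
  have split1: "cmod (F z) \<le> A * A" if "cmod (f z ^ N * gP z) \<le> A" "cmod (f (- z) ^ N * gQ z) \<le> A" for z
  proof -
    have "F z = (f z ^ N * gP z) * (f (- z) ^ N * gQ z)" by (simp add: F_def)
    then show ?thesis using that by (simp only: norm_mult[of "f z ^ N * gP z"]) (intro mult_mono, use A1 in auto)
  qed
  have split2: "cmod (F z) \<le> A * A" if "cmod (f (- z) ^ N * gP z) \<le> A" "cmod (f z ^ N * gQ z) \<le> A" for z
  proof -
    have "F z = (f (- z) ^ N * gP z) * (f z ^ N * gQ z)" by (simp add: F_def)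
    then show ?thesis using that by (simp only: norm_mult[of "f (- z) ^ N * gP z"]) (intro mult_mono, use A1 in auto)
  qed
  have step1': "cmod (f (- z) ^ N * gQ z) \<le> A" if "off ZQ z" for z
    using step1[OF off_minus[OF that]] gQ(2) by simp
  have F0: "cmod (F 0) \<le> A * A"
  proof (rule maximum_modulus_holes[of "ZP \<union> ZQ" r F])
    show "continuous_on {z. cmod z \<le> 1 \<and> (\<forall>t\<in>ZP \<union> ZQ. r \<le> cmod (z - of_real t) \<and> r \<le> cmod (z + of_real t))} F"
    proof -
      have "continuous_on {z. off (ZP \<union> ZQ) z} gP" "continuous_on {z. off (ZP \<union> ZQ) z} gQ"
        using cont_g[OF gP(1)] cont_g[OF gQ(1)] offU by (auto elim!: continuous_on_subset)
      then have "continuous_on {z. off (ZP \<union> ZQ) z} F"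
        unfolding F_def by (intro continuous_intros cont_f cont_f')
      then show ?thesis by (simp add: off_def)
    qed
    show "F holomorphic_on {z. cmod z < 1 \<and> (\<forall>t\<in>ZP \<union> ZQ. r < cmod (z - of_real t) \<and> r < cmod (z + of_real t))}"
      unfolding F_def by (intro holomorphic_intros hol_f hol_f' hol_g[OF gP(1)] hol_g[OF gQ(1)]) auto
    show "cmod (F z) \<le> A * A" if "cmod z = 1" for z
    proof -
      have "cmod (F z) \<le> (1 ^ N * 1 ^ N) * (1 * 1)"
        unfolding F_def norm_mult norm_power using that f1 gP(3) gQ(3) by (intro mult_mono power_mono) auto
      also have "\<dots> \<le> A * A" using mult_mono[OF A1 A1] A1 by simp
      finally show ?thesis .
    qed
    show "cmod (F z) \<le> A * A"
      if z: "z \<in> {z. cmod z \<le> 1 \<and> (\<forall>t\<in>ZP \<union> ZQ. r \<le> cmod (z - of_real t) \<and> r \<le> cmod (z + of_real t))}"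
        and t: "t \<in> ZP \<union> ZQ" and hole: "cmod (z - of_real t) = r \<or> cmod (z + of_real t) = r" for z t
    proof -
      have off: "off ZP z" "off ZQ z" using z offU[of z] by (auto simp: off_def)
      have z1: "cmod z \<le> 1" "cmod (- z) \<le> 1" using z by auto
      have flip: "cmod (- z - of_real t) = cmod (z + of_real t)" "cmod (- z + of_real t) = cmod (z - of_real t)"
        using norm_minus_cancel[of "z + of_real t"] norm_minus_commute[of z "of_real t"] by (simp_all add: algebra_simps)
      have "t \<in> P" using t ZP ZQ by (auto simp: P_def Q_def)
      then have "cmod (f z) \<le> q \<or> cmod (f (- z)) \<le> q"
        using hole K_near[of z t] K_near[of "- z" t] K_near'[of z t] K_near'[of "- z" t] z1 flip
        by (auto simp: P_def)
      then show ?thesis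
        using split1[of z] split2[of z] small[of z "gP z"] small[of "- z" "gP z"] gP_D[OF off(1)]
          step1[OF off(2)] step1'[OF off(2)] by blast
    qed
    \<comment> \<open>The origin must lie outside every hole: otherwise \<open>near\<close> at z = 0
      would give |f 0| <= q.\<close>
    have "r \<le> \<bar>t\<bar>" if "t \<in> ZP \<union> ZQ" for t
    proof (rule ccontr)
      assume "\<not> r \<le> \<bar>t\<bar>"
      moreover have "t \<in> K \<or> - t \<in> K" using that ZP ZQ by (auto simp: P_def Q_def)
      ultimately have "cmod (f 0) \<le> q" using near[of 0 t] near[of 0 "- t"] by auto
      then show False using f0 by simp
    qed
    then show "0 \<in> {z. cmod z \<le> 1 \<and> (\<forall>t\<in>ZP \<union> ZQ. r \<le> cmod (z - of_real t) \<and> r \<le> cmod (z + of_real t))}"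
      by simp
  qed (use ZP ZQ in auto)
  have lower: "exp (4 * k / pi * \<psi> \<delta> - c) \<le> cmod (gP 0) * cmod (gQ 0)"
  proof -
    have m_le: "measure lborel S \<le> 1" if "S \<subseteq> {0..1}" "S \<in> sets borel" for S :: "real set"
      using measure_mono_fmeasurable[of S "{0..1}" lborel] that by (simp add: fmeasurable_def)
    have [measurable]: "K \<in> sets borel" "uminus ` K \<in> sets borel" using K K' by (simp_all add: borel_compact)
    have fm: "S \<in> fmeasurable lborel" if "S \<subseteq> {-1..1}" "S \<in> sets borel" for S :: "real set"
      by (rule fmeasurableI2[of "{-1..1}"]) (use that in \<open>auto simp: fmeasurable_def\<close>)
    have b: "0 \<le> bP" "0 \<le> bQ" using m_le[of P] m_le[of Q] by (auto simp: bP_def bQ_def P_def Q_def)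
    \<comment> \<open>The negative half of \<open>K\<close> is reflected to the positive side; by
      inclusion-exclusion the two halves then have total length |P| + |Q|.\<close>
    have "measure lborel K \<le> measure lborel ((K \<inter> {0..1}) \<union> uminus ` (uminus ` K \<inter> {0..1}))"
    proof (rule measure_mono_fmeasurable)
      show "K \<subseteq> (K \<inter> {0..1}) \<union> uminus ` (uminus ` K \<inter> {0..1})"
      proof
        fix x assume x: "x \<in> K"
        show "x \<in> (K \<inter> {0..1}) \<union> uminus ` (uminus ` K \<inter> {0..1})"
        proof (cases "x \<ge> 0")
          case True
          then show ?thesis using x K by auto
        next
          case False
          then have "- x \<in> uminus ` K \<inter> {0..1}" using x K by auto
          then have "- (- x) \<in> uminus ` (uminus ` K \<inter> {0..1})" by (rule imageI)
          then show ?thesis by simp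
        qed
      qed
      have "uminus ` (uminus ` K \<inter> {0..1}) \<in> sets borel"
        using K K' by (intro borel_compact compact_continuous_image continuous_intros compact_Int) auto
      then show "(K \<inter> {0..1}) \<union> uminus ` (uminus ` K \<inter> {0..1}) \<in> fmeasurable lborel"
        using K by (intro fm) auto
    qed auto
    also have "\<dots> \<le> measure lborel (K \<inter> {0..1}) + measure lborel (uminus ` (uminus ` K \<inter> {0..1}))"
      using K K' by (intro measure_Un_le) (auto intro!: borel_compact compact_continuous_image continuous_intros compact_Int)
    also have "measure lborel (uminus ` (uminus ` K \<inter> {0..1})) = measure lborel (uminus ` K \<inter> {0..1})"
      by (intro measure_reflect_real) auto
    also have "measure lborel (K \<inter> {0..1}) + measure lborel (uminus ` K \<inter> {0..1}) = measure lborel P + measure lborel Q"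
    proof -
      have "P = (K \<inter> {0..1}) \<union> (uminus ` K \<inter> {0..1})" "Q = (K \<inter> {0..1}) \<inter> (uminus ` K \<inter> {0..1})"
        by (auto simp: P_def Q_def)
      moreover have "K \<inter> {0..1} \<in> fmeasurable lborel" "uminus ` K \<inter> {0..1} \<in> fmeasurable lborel"
        by (rule fm; force)+
      ultimately show ?thesis
        using measure_Un3[of "K \<inter> {0..1}" lborel "uminus ` K \<inter> {0..1}"] by simp
    qed
    finally have "bP + bQ \<le> 2 * \<delta>" using delta by (simp add: bP_def bQ_def)
    then have "arctan ((bP + bQ) / 2) \<le> arctan \<delta>" by (intro arctan_monotone') simp
    then have "arctan bP + arctan bQ \<le> 2 * arctan \<delta>"
      using arctan_midpoint[OF b] by linarith
    then have "2 * \<psi> \<delta> \<le> \<psi> bP + \<psi> bQ"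
      unfolding \<psi>_def using b delta by (simp add: arcsin_eq_arctan)
    then have "2 * k / pi * (2 * \<psi> \<delta>) \<le> 2 * k / pi * (\<psi> bP + \<psi> bQ)"
      using k by (intro mult_left_mono) auto
    moreover have eq: "pi * x / \<epsilon> = 2 * k / pi * x" for x
      using k by (simp add: \<epsilon>_def power2_eq_square)
    ultimately have "4 * k / pi * \<psi> \<delta> - c \<le> (pi * \<psi> bP / \<epsilon> - (2 * artanh (sin (\<psi> bP)) + 2))
       + (pi * \<psi> bQ / \<epsilon> - (2 * artanh (sin (\<psi> bQ)) + 2))"
      unfolding eq c_def distrib_left by linarith
    then have "exp (4 * k / pi * \<psi> \<delta> - c) \<le> exp (pi * \<psi> bP / \<epsilon> - (2 * artanh (sin (\<psi> bP)) + 2))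
       * exp (pi * \<psi> bQ / \<epsilon> - (2 * artanh (sin (\<psi> bQ)) + 2))"
      by (simp only: exp_add[symmetric] exp_le_cancel_iff)
    also have "\<dots> \<le> cmod (gP 0) * cmod (gQ 0)" using gP0 gQ0 by (intro mult_mono) auto
    finally show ?thesis .
  qed
  have "cmod (f 0) ^ (2 * N) * exp (4 * k / pi * \<psi> \<delta> - c) \<le> cmod (f 0) ^ (2 * N) * (cmod (gP 0) * cmod (gQ 0))"
    using lower by (intro mult_left_mono) auto
  also have "\<dots> = cmod (F 0)"
    by (simp add: F_def norm_mult norm_power power_mult power2_eq_square power_mult_distrib)
  also have "\<dots> \<le> A * A" by (rule F0)
  finally have "cmod (f 0) ^ (2 * N) * (exp (4 * k / pi * \<psi> \<delta>) / exp c) \<le> A * A"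
    by (simp only: exp_diff)
  moreover have "x * y \<le> exp c * A\<^sup>2" if "x * (y / exp c) \<le> A * A" for x y
    using that by (simp add: field_simps power2_eq_square)
  ultimately have "cmod (f 0) ^ (2 * N) * exp (4 * k / pi * \<psi> \<delta>) \<le> exp c * A\<^sup>2" by blast
  moreover have "exp (4 * k / pi * \<psi> \<delta>) = M powr (- 2 * (2 / pi * \<psi> \<delta>) * N)"
    using M by (simp add: powr_def k_def L_def)
  moreover have "4 / \<epsilon> = 8 * (- ln M) / pi\<^sup>2 * N" by (simp add: \<epsilon>_def k_def L_def)
  ultimately show ?thesis by (simp add: A_def D_def)
qed

text \<open>If |f 0| exceeded M^h, the power bound would force an exponential in \<open>N\<close>
  below a quadratic in \<open>N\<close>.\<close>

lemma two_constants_linear_set: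
  fixes f :: "complex \<Rightarrow> complex" and M \<delta> h :: real
  assumes cont: "continuous_on (cball 0 1) f" and hol: "f holomorphic_on ball 0 1"
    and f1: "\<And>z. cmod z \<le> 1 \<Longrightarrow> cmod (f z) \<le> 1"
    and M: "0 < M" "M \<le> 1" and delta: "0 < \<delta>" "\<delta> < 1"
    and bad: "measure lborel {x \<in> {-1<..<1}. M < cmod (f (of_real x))} \<le> 2 * \<delta>"
    and h: "h = 2 / pi * arcsin ((1 - \<delta>\<^sup>2) / (1 + \<delta>\<^sup>2))"
  shows "cmod (f 0) \<le> M powr h"
proof (rule ccontr)
  assume "\<not> cmod (f 0) \<le> M powr h"
  then have f0: "M powr h < cmod (f 0)" by simp
  have M1: "M < 1" using f0 f1[of 0] M by (cases "M = 1") auto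
  have h1: "h \<le> 1"
  proof -
    have "arcsin ((1 - \<delta>\<^sup>2) / (1 + \<delta>\<^sup>2)) \<le> pi / 2"
      using arcsin_eq_arctan[of \<delta>] delta zero_less_arctan_iff[of \<delta>] by linarith
    then show ?thesis by (simp add: h field_simps)
  qed
  have Mh: "M \<le> M powr h" "0 < M powr h" using powr_mono'[of h 1 M] h1 M by auto
  \<comment> \<open>Half of the relative excess of |f 0| over M^h. Raising the level from
    \<open>M\<close> to \<open>q\<close> costs the factor 1 + \<eta>, and what remains still gives
    \<rho> > 1.\<close>
  define \<eta> where "\<eta> = (cmod (f 0) / M powr h - 1) / 2"
  have eta: "\<eta> > 0" using f0 Mh by (simp add: \<eta>_def)
  have rho: "(1 + \<eta>) * M powr h < cmod (f 0)" using f0 Mh by (simp add: \<eta>_def field_simps)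
  define q where "q = (1 + \<eta>) * M"
  have q: "M < q" using M eta by (simp add: q_def)
  have q0: "q < cmod (f 0)"
    using rho mult_left_mono[OF Mh(1), of "1 + \<eta>"] eta unfolding q_def by linarith
  define K where "K = {x \<in> {-1..1}. cmod (f (of_real x)) \<le> M}"
  have contr: "continuous_on {-1..1} (\<lambda>x::real. cmod (f (of_real x)))"
    by (intro continuous_intros continuous_on_compose2[OF cont]) auto
  have K: "compact K" "K \<subseteq> {-1..1}"
  proof -
    have "K = {-1..1} \<inter> (\<lambda>x. cmod (f (of_real x))) -` {..M}" by (auto simp: K_def)
    then have "closed K" using continuous_closed_preimage[OF contr, of "{..M}"] by simp
    then show "compact K" "K \<subseteq> {-1..1}"
      by (auto simp: compact_eq_bounded_closed K_def intro: bounded_subset[of "{-1..1}"])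
  qed
  have mK: "2 - 2 * \<delta> \<le> measure lborel K"
  proof -
    define E where "E = {x \<in> {-1<..<1}. M < cmod (f (of_real x))}"
    have "open E"
    proof -
      have "continuous_on {-1<..<1} (\<lambda>x::real. cmod (f (of_real x)))"
        by (rule continuous_on_subset[OF contr]) auto
      then have "open ({-1<..<1} \<inter> (\<lambda>x. cmod (f (of_real x))) -` {M<..})"
        by (intro continuous_open_preimage) auto
      moreover have "E = {-1<..<1} \<inter> (\<lambda>x. cmod (f (of_real x))) -` {M<..}" by (auto simp: E_def)
      ultimately show ?thesis by simp
    qed
    have "measure lborel {-1<..<1::real} \<le> measure lborel (E \<union> K)"
    proof (rule measure_mono_fmeasurable)
      show "{-1<..<1} \<subseteq> E \<union> K" by (auto simp: E_def K_def)
      show "E \<union> K \<in> fmeasurable lborel"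
        by (rule fmeasurableI2[of "{-1..1}"])
          (use K \<open>open E\<close> in \<open>auto simp: fmeasurable_def E_def[symmetric] borel_compact, auto simp: E_def\<close>)
    qed auto
    also have "\<dots> \<le> measure lborel E + measure lborel K"
      using K \<open>open E\<close> by (intro measure_Un_le) (auto simp: borel_compact)
    finally show ?thesis using bad by (simp add: E_def)
  qed
  obtain r where r: "0 < r" "r \<le> 1"
    and near: "\<And>z x. cmod z \<le> 1 \<Longrightarrow> x \<in> K \<Longrightarrow> cmod (z - of_real x) \<le> r \<Longrightarrow> cmod (f z) \<le> q"
  proof -
    have "uniformly_continuous_on (cball 0 1) f"
      by (rule compact_uniformly_continuous[OF cont]) auto
    moreover have "q - M > 0" using q by simp
    ultimately obtain d where d: "d > 0"
      "\<And>x x'. x \<in> cball 0 1 \<Longrightarrow> x' \<in> cball 0 1 \<Longrightarrow> dist x' x < d \<Longrightarrow> dist (f x') (f x) < q - M"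
      unfolding uniformly_continuous_on_def by metis
    show ?thesis
    proof (rule that[of "min 1 (d / 2)"])
      fix z :: complex and x assume z: "cmod z \<le> 1" "x \<in> K" "cmod (z - of_real x) \<le> min 1 (d / 2)"
      have "cmod (f (of_real x)) \<le> M" "of_real x \<in> cball (0::complex) 1" using z by (auto simp: K_def)
      then have "cmod (f z - f (of_real x)) < q - M"
        using d(2)[of "of_real x" z] z d(1) by (simp add: dist_norm)
      then show "cmod (f z) \<le> q"
        using \<open>cmod (f (of_real x)) \<le> M\<close> norm_triangle_ineq2[of "f z" "f (of_real x)"] by linarith
    qed (use d in auto)
  qed
  define \<psi> where "\<psi> = (\<lambda>b::real. arcsin ((1 - b\<^sup>2) / (1 + b\<^sup>2)))"
  define c where "c = (2 * artanh (sin (\<psi> (1 - measure lborel ((K \<union> uminus ` K) \<inter> {0..1})))) + 2)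
     + (2 * artanh (sin (\<psi> (1 - measure lborel ((K \<inter> uminus ` K) \<inter> {0..1})))) + 2)"
  define E where "E = 8 * (- ln M) / pi\<^sup>2"
  have E: "E \<ge> 0" unfolding E_def using M M1 by (intro divide_nonneg_nonneg mult_nonneg_nonneg) auto
  define \<rho> where "\<rho> = cmod (f 0) / ((1 + \<eta>) * M powr h)"
  have rho1: "\<rho> > 1" using rho eta Mh by (simp add: \<rho>_def)
  define C where "C = exp (c / 2) * (2 / r\<^sup>2)"
  have C: "C > 0" using r by (simp add: C_def)
  have "\<rho> ^ N \<le> C * (1 + E * N)\<^sup>2" if "N \<ge> 1" for N :: nat
  proof -
    define p e b where "p = (M powr h) ^ N" and "e = (1 + \<eta>) ^ N" and "b = 2 / r\<^sup>2 * (1 + E * N)\<^sup>2"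
    have pos: "p > 0" "e > 0" "b \<ge> 0" using Mh eta by (auto simp: p_def e_def b_def)
    have bound: "cmod (f 0) ^ (2 * N) * M powr (- 2 * h * N) \<le> exp c * (b * e)\<^sup>2"
      using two_constants_power_bound[OF cont hol f1 M(1) M1 less_imp_le[OF q] r K near q0 that mK delta]
      using M by (simp add: c_def \<psi>_def E_def h q_def b_def e_def)
    have "p\<^sup>2 = M powr (h * (N * 2))"
      using M by (simp add: p_def power_mult[symmetric] powr_realpow[symmetric] powr_powr mult.assoc)
    then have "M powr (- 2 * h * N) = 1 / p\<^sup>2" using M by (simp add: powr_minus_divide mult_ac)
    moreover have "exp c = (exp (c / 2))\<^sup>2" by (simp add: power2_eq_square exp_add[symmetric])
    ultimately have "(cmod (f 0) ^ N / p)\<^sup>2 \<le> (exp (c / 2) * (b * e))\<^sup>2"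
      using bound by (simp add: power_mult_distrib power_divide power_mult[symmetric] mult.commute)
    then have "cmod (f 0) ^ N / p \<le> exp (c / 2) * (b * e)"
      by (rule power2_le_imp_le) (use pos in auto)
    then have "cmod (f 0) ^ N / p / e \<le> exp (c / 2) * b"
      using pos by (simp add: divide_le_eq mult_ac)
    moreover have "\<rho> ^ N = cmod (f 0) ^ N / p / e"
      by (simp add: \<rho>_def p_def e_def power_divide power_mult_distrib mult.commute)
    ultimately show ?thesis by (simp add: C_def b_def mult.assoc)
  qed
  then show False using not_power_le_polynomial[OF rho1 C E] by (meson not_le)
qed

lemma two_constants_segment:
  fixes f :: "complex \<Rightarrow> complex" and M A r \<delta> h :: real
  assumes cont: "continuous_on (cball 0 r) f" and hol: "f holomorphic_on ball 0 r" and r: "r > 0"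
    and fA: "\<And>z. cmod z \<le> r \<Longrightarrow> cmod (f z) \<le> A"
    and M: "0 < M" "M \<le> A" and delta: "0 < \<delta>" "\<delta> < 1"
    and bad: "measure lborel {x \<in> {-r<..<r}. M < cmod (f (of_real x))} / (2 * r) \<le> \<delta>"
    and h: "h = 2 / pi * arcsin ((1 - \<delta>\<^sup>2) / (1 + \<delta>\<^sup>2))"
  shows "cmod (f 0) \<le> M powr h * A powr (1 - h)"
proof -
  have A: "A > 0" using M by simp
  define F where "F = (\<lambda>z. f (of_real r * z) / of_real A)"
  have sc: "(\<lambda>z. of_real r * z) ` cball (0::complex) 1 \<subseteq> cball 0 r" "(\<lambda>z. of_real r * z) ` ball (0::complex) 1 \<subseteq> ball 0 r"
    using r by (auto simp: norm_mult)
  have "cmod (F 0) \<le> (M / A) powr h"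
  proof (rule two_constants_linear_set[OF _ _ _ _ _ delta _ h])
    show "continuous_on (cball 0 1) F"
      unfolding F_def using A sc by (intro continuous_intros continuous_on_compose2[OF cont]) auto
    show "F holomorphic_on ball 0 1"
      unfolding F_def using A sc
      by (intro holomorphic_intros holomorphic_on_compose_gen[OF _ hol, unfolded o_def]) auto
    show "cmod (F z) \<le> 1" if "cmod z \<le> 1" for z
      using fA[of "of_real r * z"] that r A by (simp add: F_def norm_mult norm_divide)
    show "0 < M / A" "M / A \<le> 1" using M A by auto
    have "{x \<in> {-1<..<1}. M / A < cmod (F (of_real x))} = (\<lambda>x. x / r) ` {x \<in> {-r<..<r}. M < cmod (f (of_real x))}" (is "?L = _ ` ?R")
    proof (intro set_eqI iffI)
      fix x assume "x \<in> ?L"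
      then have "r * (-1) < r * x" "r * x < r * 1" using r by (intro mult_strict_left_mono; simp)+
      then have "r * x \<in> ?R" using \<open>x \<in> ?L\<close> A by (auto simp: F_def norm_divide divide_less_cancel)
      then show "x \<in> (\<lambda>x. x / r) ` ?R" using r by (intro image_eqI[of _ _ "r * x"]) auto
    next
      fix x assume "x \<in> (\<lambda>x. x / r) ` ?R"
      then show "x \<in> ?L" using r A by (auto simp: F_def norm_divide field_simps)
    qed
    moreover have op: "open ?R"
    proof -
      have "continuous_on {-r<..<r} (\<lambda>x::real. cmod (f (of_real x)))"
        by (intro continuous_intros continuous_on_compose2[OF cont]) auto
      then have "open ({-r<..<r} \<inter> (\<lambda>x. cmod (f (of_real x))) -` {M<..})"
        by (intro continuous_open_preimage) auto
      moreover have "?R = {-r<..<r} \<inter> (\<lambda>x. cmod (f (of_real x))) -` {M<..}" by auto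
      ultimately show ?thesis by simp
    qed
    moreover have "open ?L"
    proof -
      have "?L = (\<lambda>x. r * x) -` ?R"
        unfolding \<open>?L = (\<lambda>x. x / r) ` ?R\<close> using r by (auto intro!: image_eqI[of _ _ "r * _"])
      then show ?thesis using op by (simp only:) (intro open_vimage continuous_intros)
    qed
    \<comment> \<open>Both sets are open, so \<open>lebesgue\<close> and \<open>lborel\<close>
      assign them the same measure.\<close>
    moreover have "measure lebesgue ((\<lambda>x. (1/r) *\<^sub>R x + 0) ` ?R) = \<bar>1/r\<bar> ^ DIM(real) * measure lebesgue ?R"
      by (rule measure_lebesgue_affine)
    ultimately have "measure lborel ?L = measure lborel ?R / r" using r by simp
    moreover have "measure lborel ?R / r \<le> 2 * \<delta>" using bad r by (simp add: field_simps)
    ultimately show "measure lborel ?L \<le> 2 * \<delta>" by (simp only:)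
  qed
  then have "cmod (f 0) / A \<le> M powr h / A powr h" using A M by (simp add: F_def norm_divide powr_divide)
  then have "cmod (f 0) \<le> M powr h / A powr h * A" using A by (simp add: field_simps)
  also have "\<dots> = M powr h * A powr (1 - h)" using A by (simp add: powr_diff)
  finally show ?thesis .
qed

section \<open>Fields with an analytic extension to a strip\<close>

lemma esssup_norm_nonneg:
  fixes f :: "real^3 \<Rightarrow> real^3"
  assumes "f \<in> borel_measurable lborel"
  shows "0 \<le> esssup lborel (\<lambda>x. ereal (norm (f x)))"
proof -
  have "esssup lborel (\<lambda>x::real^3. 0::ereal) \<le> esssup lborel (\<lambda>x. ereal (norm (f x)))"
    by (rule esssup_mono) auto
  then show ?thesis using esssup_const[of "lborel :: (real^3) measure" "0::ereal"] by simp
qed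

lemma linf_nonneg: "Linf f \<Longrightarrow> 0 \<le> linf f"
  unfolding Linf_def linf_def using esssup_norm_nonneg by (simp add: real_of_ereal_pos)

lemma
  fixes f :: "real^3 \<Rightarrow> real^3"
  assumes f: "continuous_on UNIV f" and c: "\<And>x. norm (f x) \<le> c"
  shows linf_le: "linf f \<le> c" and Linf_continuous: "Linf f"
proof -
  have m: "f \<in> borel_measurable lborel" using f by (simp add: borel_measurable_continuous_onI)
  then have "(\<lambda>x. ereal (norm (f x))) \<in> borel_measurable lborel" by measurable
  then have le: "esssup lborel (\<lambda>x. ereal (norm (f x))) \<le> ereal c"
    using c by (intro esssup_I) auto
  then show "Linf f" using m by (auto simp: Linf_def intro: le_less_trans)
  show "linf f \<le> c" using le esssup_norm_nonneg[OF m] unfolding linf_def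
    by (cases "esssup lborel (\<lambda>x. ereal (norm (f x)))") auto
qed

text \<open>For continuous \<open>f\<close> the set where the norm exceeds the essential supremum is
  open and null, hence empty.\<close>

lemma norm_le_linf:
  fixes f :: "real^3 \<Rightarrow> real^3"
  assumes f: "continuous_on UNIV f" and "Linf f"
  shows "norm (f x) \<le> linf f"
proof (rule ccontr)
  assume "\<not> norm (f x) \<le> linf f"
  define S where "S = {x. linf f < norm (f x)}"
  have "open S" unfolding S_def using f by (intro open_Collect_less continuous_intros)
  have "esssup lborel (\<lambda>x. ereal (norm (f x))) = ereal (linf f)"
    using assms esssup_norm_nonneg[of f] unfolding Linf_def linf_def
    by (cases "esssup lborel (\<lambda>x. ereal (norm (f x)))") auto
  then have "AE x in lborel. norm (f x) \<le> linf f"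
    using esssup_AE[of "\<lambda>x. ereal (norm (f x))" lborel] by simp
  then have "AE x in lborel. x \<notin> S" by (simp add: S_def not_less)
  then have "S \<in> null_sets lborel" using \<open>open S\<close> by (subst (asm) AE_iff_null_sets[symmetric]) auto
  then have "negligible S" by (simp add: negligible_iff_null_sets null_sets_completionI)
  then have "S = {}" using \<open>open S\<close> open_not_negligible by blast
  then show False using \<open>\<not> norm (f x) \<le> linf f\<close> by (auto simp: S_def not_less)
qed

section \<open>Holomorphic slices along complex lines\<close>

lemma cvec_nth [simp]: "cvec x $ k = of_real (x $ k)"
  by (simp add: cvec_def)

lemma norm_cvec [simp]: "norm (cvec x) = norm x"
  by (simp add: norm_vec_def)

lemma cvec_line: "cvec x + of_real s *s cvec d = cvec (x + s *\<^sub>R d)"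
  by (simp add: vec_eq_iff)

lemma strip_line: "norm d = 1 \<Longrightarrow> cmod \<zeta> \<le> r \<Longrightarrow> cvec x + \<zeta> *s cvec d \<in> strip r"
proof -
  assume d: "norm d = 1" and z: "cmod \<zeta> \<le> r"
  have "Imv (cvec x + \<zeta> *s cvec d) = Im \<zeta> *\<^sub>R d" by (simp add: Imv_def vec_eq_iff)
  then show ?thesis using d z abs_Im_le_cmod[of \<zeta>] by (simp add: strip_def)
qed

lemma strip_cvec: "0 \<le> r \<Longrightarrow> cvec x \<in> strip r"
  by (simp add: strip_def Imv_def zero_vec_def[symmetric])

lemma strip_mono: "r \<le> s \<Longrightarrow> strip r \<subseteq> strip s"
  by (auto simp: strip_def)

lemma analytic3_on_subset: "analytic3_on S F \<Longrightarrow> R \<subseteq> S \<Longrightarrow> analytic3_on R F"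
  unfolding analytic3_on_def by (meson order_trans)

lemma continuous_on_of_analytic3:
  fixes u :: "real^3 \<Rightarrow> real^3"
  assumes F: "analytic3_on (strip r) F" and r: "0 \<le> r" and u: "\<And>x. F (cvec x) = cvec (u x)"
  shows "continuous_on UNIV u"
proof -
  have "isCont F z" if "z \<in> strip r" for z
    using F that has_derivative_continuous unfolding analytic3_on_def by blast
  then have "continuous_on (strip r) F" by (simp add: continuous_at_imp_continuous_on)
  moreover have "continuous_on UNIV cvec"
    unfolding cvec_def by (intro continuous_intros)
  ultimately have "continuous_on UNIV (\<lambda>x. F (cvec x))"
    by (rule continuous_on_compose2) (use strip_cvec[OF r] in auto)
  then have "continuous_on UNIV (\<lambda>x. \<chi> k. Re (F (cvec x) $ k))" by (intro continuous_intros)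
  moreover have "(\<chi> k. Re (F (cvec x) $ k)) = u x" for x by (simp add: u vec_eq_iff)
  ultimately show ?thesis by simp
qed

text \<open>Complex linearity of the derivative \<open>L\<close> makes w -> L (w *s d)
  multiplication by a fixed vector, so its component along \<open>e\<close> is multiplication by a
  complex number.\<close>

lemma field_differentiable_slice:
  fixes F :: "complex^3 \<Rightarrow> complex^3" and e :: "real^3"
  assumes F: "analytic3_on S F" and z: "p + \<zeta> *s d \<in> S"
  shows "(\<lambda>\<zeta>. \<Sum>k\<in>UNIV. of_real (e $ k) * F (p + \<zeta> *s d) $ k) field_differentiable (at \<zeta>)"
proof -
  obtain L where L: "(F has_derivative L) (at (p + \<zeta> *s d))" "\<And>c w. L (c *s w) = c *s L w"
    using F z unfolding analytic3_on_def by blast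
  have g: "((\<lambda>\<zeta>. p + \<zeta> *s d) has_derivative (\<lambda>w. w *s d)) (at \<zeta>)"
  proof -
    have "bounded_linear (\<lambda>w. w *s d)"
      by (intro linear_conv_bounded_linear[THEN iffD1] linearI) (auto simp: vec_eq_iff algebra_simps)
    then show ?thesis using has_derivative_add[OF has_derivative_const bounded_linear_imp_has_derivative] by fastforce
  qed
  have "((\<lambda>\<zeta>. F (p + \<zeta> *s d)) has_derivative (\<lambda>w. L (w *s d))) (at \<zeta>)"
    by (rule has_derivative_compose[OF g L(1)])
  then have "((\<lambda>\<zeta>. F (p + \<zeta> *s d) $ k) has_derivative (\<lambda>w. L (w *s d) $ k)) (at \<zeta>)" for k
    by (rule bounded_linear.has_derivative[OF bounded_linear_vec_nth])
  then have "((\<lambda>\<zeta>. \<Sum>k\<in>UNIV. of_real (e $ k) * F (p + \<zeta> *s d) $ k) has_derivative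
      (\<lambda>w. \<Sum>k\<in>UNIV. of_real (e $ k) * L (w *s d) $ k)) (at \<zeta>)"
    by (intro has_derivative_sum has_derivative_mult_right)
  moreover have "(\<lambda>w. \<Sum>k\<in>UNIV. of_real (e $ k) * L (w *s d) $ k) = (*) (\<Sum>k\<in>UNIV. of_real (e $ k) * L d $ k)"
    by (auto simp: L(2) sum_distrib_left sum_distrib_right mult_ac)
  ultimately show ?thesis
    unfolding field_differentiable_def has_field_derivative_def by auto
qed

lemma cmod_slice_le:
  fixes e :: "real^3" and w :: "complex^3"
  shows "cmod (\<Sum>k\<in>UNIV. of_real (e $ k) * w $ k) \<le> norm e * norm w"
proof -
  have "cmod (\<Sum>k\<in>UNIV. of_real (e $ k) * w $ k) \<le> (\<Sum>k\<in>UNIV. \<bar>e $ k\<bar> * \<bar>cmod (w $ k)\<bar>)"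
    by (rule order_trans[OF norm_sum]) (simp add: norm_mult)
  also have "\<dots> \<le> L2_set (\<lambda>k. e $ k) UNIV * L2_set (\<lambda>k. cmod (w $ k)) UNIV"
    by (rule L2_set_mult_ineq)
  finally show ?thesis by (simp add: norm_vec_def L2_set_def)
qed

text \<open>Where the slice of an \<eta>-close field exceeds M + \<eta>, the field \<open>v\<close>
  exceeds \<open>M\<close>, so sparseness passes to the slice at the raised level. The two-constants
  bound then survives the limit \<eta> -> 0.\<close>

lemma sparse_level_bound:
  fixes v :: "real^3 \<Rightarrow> real^3" and M A r \<rho> \<delta> h :: real
  assumes v: "continuous_on UNIV v" and M: "0 < M" "M < A" and r: "0 < r" "r \<le> \<rho>"
    and delta: "0 < \<delta>" "\<delta> < 1" and h: "h = 2 / pi * arcsin ((1 - \<delta>\<^sup>2) / (1 + \<delta>\<^sup>2))"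
    and sparse: "lin_sparse {x. norm (v x) > M} \<delta> x0 r"
    and approx: "\<And>\<eta>. \<eta> > 0 \<Longrightarrow> \<exists>u F. analytic3_on (strip \<rho>) F \<and> (\<forall>x. F (cvec x) = cvec (u x)) \<and>
       (\<forall>z\<in>strip \<rho>. norm (F z) \<le> A) \<and> (\<forall>x. norm (u x - v x) \<le> \<eta>)"
  shows "norm (v x0) \<le> M powr h * A powr (1 - h)"
proof -
  obtain d where d: "norm d = 1"
    and sp: "measure lborel {s \<in> {-r<..<r}. M < norm (v (x0 + s *\<^sub>R d))} / (2 * r) \<le> \<delta>"
    using sparse by (auto simp: lin_sparse_def)
  have step: "norm (v x0) \<le> \<eta> + (M + \<eta>) powr h * A powr (1 - h)" if eta: "0 < \<eta>" "\<eta> < A - M" for \<eta>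
  proof -
    obtain u F where F: "analytic3_on (strip \<rho>) F" "\<And>x. F (cvec x) = cvec (u x)"
      "\<And>z. z \<in> strip \<rho> \<Longrightarrow> norm (F z) \<le> A" and uv: "\<And>x. norm (u x - v x) \<le> \<eta>"
      using approx[OF eta(1)] by blast
    \<comment> \<open>The direction of \<open>u x0\<close>: the scalar slice along it has modulus |u
      x0| at 0 and at most |F| elsewhere. If \<open>u x0 = 0\<close> then e = 0, which is consistent
      with both.\<close>
    define e where "e = (1 / norm (u x0)) *\<^sub>R u x0"
    have e1: "norm e \<le> 1" by (simp add: e_def)
    define f where "f = (\<lambda>\<zeta>. \<Sum>k\<in>UNIV. of_real (e $ k) * F (cvec x0 + \<zeta> *s cvec d) $ k)"
    have diff: "f field_differentiable (at \<zeta>)" if "cmod \<zeta> \<le> r" for \<zeta>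
      unfolding f_def using r that by (intro field_differentiable_slice[OF F(1)] strip_line[OF d]) auto
    have contf: "continuous_on (cball 0 r) f"
    proof (intro continuous_at_imp_continuous_on ballI)
      fix z :: complex assume "z \<in> cball 0 r"
      then show "isCont f z" using field_differentiable_imp_continuous_at[OF diff[of z]] by simp
    qed
    have holf: "f holomorphic_on ball 0 r"
      unfolding holomorphic_on_def
    proof
      fix z :: complex assume "z \<in> ball 0 r"
      then show "f field_differentiable (at z within ball 0 r)"
        using field_differentiable_at_within[OF diff[of z]] by simp
    qed
    have fle: "cmod (f \<zeta>) \<le> norm (F (cvec x0 + \<zeta> *s cvec d))" for \<zeta>
      unfolding f_def by (rule order_trans[OF cmod_slice_le]) (use mult_right_mono[OF e1] in auto)
    have real: "cmod (f (of_real s)) \<le> norm (v (x0 + s *\<^sub>R d)) + \<eta>" for s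
      using fle[of "of_real s"] uv[of "x0 + s *\<^sub>R d"] norm_triangle_ineq2[of "u (x0 + s *\<^sub>R d)" "v (x0 + s *\<^sub>R d)"]
      by (simp add: cvec_line F(2))
    have "cmod (f 0) = norm (u x0)"
    proof -
      have "f 0 = of_real (e \<bullet> u x0)" by (simp add: f_def F(2) inner_vec_def)
      also have "e \<bullet> u x0 = norm (u x0)" by (simp add: e_def power2_norm_eq_inner[symmetric] power2_eq_square)
      finally show ?thesis by simp
    qed
    moreover have "cmod (f 0) \<le> (M + \<eta>) powr h * A powr (1 - h)"
    proof (rule two_constants_segment[OF _ _ r(1) _ _ _ delta _ h])
      show "continuous_on (cball 0 r) f" by (rule contf)
      show "f holomorphic_on ball 0 r" by (rule holf)
      show "cmod (f z) \<le> A" if "cmod z \<le> r" for z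
        using fle[of z] F(3)[of "cvec x0 + z *s cvec d"] strip_line[OF d, of z \<rho> x0] that r by simp
      show "0 < M + \<eta>" "M + \<eta> \<le> A" using M eta by auto
      have "measure lborel {s \<in> {-r<..<r}. M + \<eta> < cmod (f (of_real s))}
          \<le> measure lborel {s \<in> {-r<..<r}. M < norm (v (x0 + s *\<^sub>R d))}"
      proof (rule measure_mono_fmeasurable)
        show "{s \<in> {-r<..<r}. M + \<eta> < cmod (f (of_real s))} \<subseteq> {s \<in> {-r<..<r}. M < norm (v (x0 + s *\<^sub>R d))}"
        proof safe
          fix s assume "M + \<eta> < cmod (f (of_real s))"
          then show "M < norm (v (x0 + s *\<^sub>R d))" using real[of s] by linarith
        qed
        have "continuous_on {-r<..<r} (\<lambda>s. cmod (f (of_real s)))"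
          by (intro continuous_intros continuous_on_compose2[OF contf]) auto
        then have "open ({-r<..<r} \<inter> (\<lambda>s. cmod (f (of_real s))) -` {M + \<eta><..})"
          by (intro continuous_open_preimage) auto
        moreover have "{s \<in> {-r<..<r}. M + \<eta> < cmod (f (of_real s))} = {-r<..<r} \<inter> (\<lambda>s. cmod (f (of_real s))) -` {M + \<eta><..}" by auto
        ultimately show "{s \<in> {-r<..<r}. M + \<eta> < cmod (f (of_real s))} \<in> sets lborel" by simp
        have "open {s. M < norm (v (x0 + s *\<^sub>R d))}"
          by (intro open_Collect_less continuous_intros continuous_on_compose2[OF v]) auto
        then have "open ({-r<..<r} \<inter> {s. M < norm (v (x0 + s *\<^sub>R d))})"
          by (rule open_Int[OF open_greaterThanLessThan])
        then have "{-r<..<r} \<inter> {s. M < norm (v (x0 + s *\<^sub>R d))} \<in> fmeasurable lborel"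
          by - (rule fmeasurableI2[of "{-r..r}" lborel], auto simp: fmeasurable_def emeasure_lborel_Icc_eq)
        then show "{s \<in> {-r<..<r}. M < norm (v (x0 + s *\<^sub>R d))} \<in> fmeasurable lborel"
          by (simp add: Int_def)
      qed
      then have "measure lborel {s \<in> {-r<..<r}. M + \<eta> < cmod (f (of_real s))} / (2 * r)
          \<le> measure lborel {s \<in> {-r<..<r}. M < norm (v (x0 + s *\<^sub>R d))} / (2 * r)"
        using r by (intro divide_right_mono) auto
      then show "measure lborel {s \<in> {-r<..<r}. M + \<eta> < cmod (f (of_real s))} / (2 * r) \<le> \<delta>"
        using sp by linarith
    qed
    moreover have "norm (v x0) \<le> norm (u x0) + \<eta>"
      using uv[of x0] norm_triangle_ineq2[of "v x0" "u x0"] norm_minus_commute[of "u x0" "v x0"] by linarith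
    ultimately show ?thesis by linarith
  qed
  have lim: "((\<lambda>\<eta>. \<eta> + (M + \<eta>) powr h * A powr (1 - h)) \<longlongrightarrow> 0 + (M + 0) powr h * A powr (1 - h)) (at_right 0)"
    using M by (intro tendsto_intros) auto
  have "eventually (\<lambda>\<eta>. norm (v x0) \<le> \<eta> + (M + \<eta>) powr h * A powr (1 - h)) (at_right 0)"
    unfolding eventually_at_right_field using M step by (intro exI[of _ "A - M"]) auto
  then show ?thesis using tendsto_lowerbound[OF lim] by simp
qed

section \<open>Levels and time stepping\<close>

text \<open>The instance \<beta> = 1, for which \<open>Tbeta\<close> is \<open>T4\<close>.\<close>

lemma analyticity_dataE:
  assumes "analyticity_data C4 T U B" "0 < s" "s < T" "0 < \<tau>" "\<tau> < T4 C4 (Anorm U B s)" "s + \<tau> < T"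
  obtains FU FB where "analytic3_on (strip (rho C4 \<tau>)) FU" "analytic3_on (strip (rho C4 \<tau>)) FB"
    "\<And>x. FU (cvec x) = cvec (U x (s + \<tau>))" "\<And>x. FB (cvec x) = cvec (B x (s + \<tau>))"
    "\<And>z. z \<in> strip (rho C4 \<tau>) \<Longrightarrow> norm (FU z) + norm (FB z) \<le> 2 * C4 * Anorm U B s"
proof -
  have "Tbeta 1 C4 (Anorm U B s) = T4 C4 (Anorm U B s)" by (simp add: Tbeta_def)
  moreover have "(1::real) \<in> {1/2<..1}" "s \<in> {0<..<T}" using assms by auto
  ultimately have "\<exists>FU FB. analytic3_on (strip (rho C4 \<tau>)) FU \<and> analytic3_on (strip (rho C4 \<tau>)) FB \<and>
           (\<forall>x. FU (cvec x) = cvec (U x (s + \<tau>)) \<and> FB (cvec x) = cvec (B x (s + \<tau>))) \<and>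
           (\<forall>z\<in>strip (rho C4 \<tau>). norm (FU z) + norm (FB z) \<le> 2 * 1 * C4 * Anorm U B s)"
    using assms unfolding analyticity_data_def by metis
  then show ?thesis using that by auto
qed

lemma rho_nonneg: "analyticity_data C4 T U B \<Longrightarrow> 0 \<le> \<tau> \<Longrightarrow> 0 \<le> rho C4 \<tau>"
  by (simp add: rho_def analyticity_data_def)

lemma analyticity_data_slices:
  assumes "analyticity_data C4 T U B" "0 < s" "s < T" "0 < \<tau>" "\<tau> < T4 C4 (Anorm U B s)" "s + \<tau> < T"
  shows "continuous_on UNIV (\<lambda>x. U x (s + \<tau>))" "continuous_on UNIV (\<lambda>x. B x (s + \<tau>))"
    "norm (U x (s + \<tau>)) + norm (B x (s + \<tau>)) \<le> 2 * C4 * Anorm U B s"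
proof -
  obtain FU FB where F: "analytic3_on (strip (rho C4 \<tau>)) FU" "analytic3_on (strip (rho C4 \<tau>)) FB"
    "\<And>x. FU (cvec x) = cvec (U x (s + \<tau>))" "\<And>x. FB (cvec x) = cvec (B x (s + \<tau>))"
    "\<And>z. z \<in> strip (rho C4 \<tau>) \<Longrightarrow> norm (FU z) + norm (FB z) \<le> 2 * C4 * Anorm U B s"
    using analyticity_dataE[OF assms] by blast
  have r: "0 \<le> rho C4 \<tau>" using rho_nonneg assms by simp
  show "continuous_on UNIV (\<lambda>x. U x (s + \<tau>))" "continuous_on UNIV (\<lambda>x. B x (s + \<tau>))"
    using continuous_on_of_analytic3[OF _ r] F by auto
  show "norm (U x (s + \<tau>)) + norm (B x (s + \<tau>)) \<le> 2 * C4 * Anorm U B s"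
    using F(5)[OF strip_cvec[OF r, of x]] by (simp add: F(3,4))
qed

lemma T4_antimono:
  assumes "1 \<le> C4" "0 < a" "a \<le> b"
  shows "T4 C4 b \<le> T4 C4 a" "0 < T4 C4 a"
proof -
  have "0 < 16 * C4 ^ 4 * a\<^sup>2" using assms by simp
  moreover have "16 * C4 ^ 4 * a\<^sup>2 \<le> 16 * C4 ^ 4 * b\<^sup>2" using assms by (intro mult_left_mono power_mono) auto
  ultimately show "T4 C4 b \<le> T4 C4 a" "0 < T4 C4 a"
    unfolding T4_def by (auto intro!: frac_le)
qed

lemma not_singular_of_T4:
  assumes data: "analyticity_data C4 T U B" and t0: "0 < t0" "t0 < T"
    and gt: "T < t0 + T4 C4 (Anorm U B t0)"
  shows "not_singular_time T U B"
proof -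
  define c where "c = 2 * C4 * Anorm U B t0"
  have "\<forall>\<^sub>F t in at_left T. t \<in> {t0<..<T}" by (rule eventually_at_left_real[OF t0(2)])
  then have "\<forall>\<^sub>F t in at_left T. linf (\<lambda>x. U x t) + linf (\<lambda>x. B x t) \<le> c + c"
  proof eventually_elim
    case (elim t)
    have t: "0 < t - t0" "t - t0 < T4 C4 (Anorm U B t0)" "t0 + (t - t0) < T" using elim gt by auto
    note sl = analyticity_data_slices[OF data t0 t, simplified]
    have "norm (U x t) \<le> c" "norm (B x t) \<le> c" for x
      using sl(3)[of x] norm_ge_zero[of "U x t"] norm_ge_zero[of "B x t"] unfolding c_def by linarith+
    then show ?case using linf_le[OF sl(1)] linf_le[OF sl(2)] by (intro add_mono) auto
  qed
  then show ?thesis unfolding not_singular_time_def by blast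
qed

text \<open>\<open>Anorm\<close> is bounded by some \<open>C\<close> up to time \<open>t\<close>, so
  \<open>T4\<close> is at least \<open>T4 C4 C\<close> at the times considered. Hence
  \<open>t\<close> lies within the analyticity time of a slightly earlier \<open>s\<close>, and its
  slices extend analytically.\<close>

lemma regular_slices_continuous:
  assumes reg: "interval_of_regularity \<nu> \<mu> U0 B0 T U B" and data: "analyticity_data C4 T U B"
    and a: "0 \<le> a" and pos: "\<And>s. a < s \<Longrightarrow> s < T \<Longrightarrow> 0 < Anorm U B s" and t: "a < t" "t < T"
  shows "continuous_on UNIV (\<lambda>x. U x t)" "continuous_on UNIV (\<lambda>x. B x t)"
proof -
  obtain C where C: "\<And>s. 0 < s \<Longrightarrow> s \<le> t \<Longrightarrow> Anorm U B s \<le> C"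
    using reg t unfolding interval_of_regularity_def Anorm_def by fastforce
  have "0 < C" using C[of t] pos[of t] a t by simp
  have C4: "1 \<le> C4" using data by (simp add: analyticity_data_def)
  define s where "s = max ((a + t) / 2) (t - T4 C4 C / 2)"
  have s: "a < s" "s < t" using t T4_antimono(2)[OF C4 \<open>0 < C\<close> order_refl] by (auto simp: s_def less_max_iff_disj)
  have "t - T4 C4 C / 2 \<le> s" by (simp add: s_def)
  then have "t - s \<le> T4 C4 C / 2" by simp
  also have "\<dots> < T4 C4 C" using T4_antimono(2)[OF C4 \<open>0 < C\<close> order_refl] by simp
  also have "\<dots> \<le> T4 C4 (Anorm U B s)" using s t a by (intro T4_antimono C4 pos C) auto
  finally have "t - s < T4 C4 (Anorm U B s)" .
  then show "continuous_on UNIV (\<lambda>x. U x t)" "continuous_on UNIV (\<lambda>x. B x t)"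
    using analyticity_data_slices(1,2)[OF data, of s "t - s"] s t a by auto
qed

text \<open>At \<open>t = t0 + T4\<close> the extension is not provided, but it is at slightly
  earlier times, which approximate \<open>t\<close> uniformly in space. Keeping \<tau> at least T4 /
  4 preserves the strip width against which the sparseness scales are measured.\<close>

lemma ex_nearby_time:
  assumes reg: "interval_of_regularity \<nu> \<mu> U0 B0 T U B" and data: "analyticity_data C4 T U B"
    and t0: "0 < t0" "t0 < T" and A: "0 < Anorm U B t0"
    and t: "t0 + T4 C4 (Anorm U B t0) / 4 \<le> t" "t \<le> t0 + T4 C4 (Anorm U B t0)" "t < T"
    and cont: "continuous_on UNIV (\<lambda>x. U x t)" "continuous_on UNIV (\<lambda>x. B x t)" and eta: "\<eta> > 0"
  obtains \<tau> where "T4 C4 (Anorm U B t0) / 4 \<le> \<tau>" "\<tau> < T4 C4 (Anorm U B t0)" "t0 + \<tau> < T"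
    "\<And>x. norm (U x (t0 + \<tau>) - U x t) \<le> \<eta>" "\<And>x. norm (B x (t0 + \<tau>) - B x t) \<le> \<eta>"
proof (cases "t < t0 + T4 C4 (Anorm U B t0)")
  case True
  then show ?thesis using that[of "t - t0"] t eta by auto
next
  case False
  define D where "D = T4 C4 (Anorm U B t0)"
  have D: "D > 0" using T4_antimono(2)[OF _ A order_refl] data by (simp add: D_def analyticity_data_def)
  have tD: "t = t0 + D" using False t by (simp add: D_def)
  have mild: "mhd_mild \<nu> \<mu> U0 B0 T U B" using reg by (simp add: interval_of_regularity_def)
  have tT: "t \<in> {0<..<T}" using t0 D tD t by auto
  have lim: "((\<lambda>s. linf (\<lambda>x. U x s - U x t)) \<longlongrightarrow> 0) (at_left t)" "((\<lambda>s. linf (\<lambda>x. B x s - B x t)) \<longlongrightarrow> 0) (at_left t)"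
    using mild tT unfolding mhd_mild_def by (auto intro: tendsto_mono[OF at_le])
  have "\<forall>\<^sub>F s in at_left t. s \<in> {t0 + D / 4<..<t} \<and> linf (\<lambda>x. U x s - U x t) < \<eta> \<and> linf (\<lambda>x. B x s - B x t) < \<eta>"
    using D tD eta by (intro eventually_conj eventually_at_left_real order_tendstoD(2)[OF lim(1)] order_tendstoD(2)[OF lim(2)]) auto
  then obtain s where s: "t0 + D / 4 < s" "s < t" "linf (\<lambda>x. U x s - U x t) < \<eta>" "linf (\<lambda>x. B x s - B x t) < \<eta>"
    using eventually_happens'[OF trivial_limit_at_left_real] by force
  have st: "0 < s - t0" "s - t0 < T4 C4 (Anorm U B t0)" "t0 + (s - t0) < T" using s D tD t by (auto simp: D_def)
  note sl = analyticity_data_slices(1,2)[OF data t0 st, simplified]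
  have sT: "s \<in> {0<..<T}" using s t t0 D by auto
  \<comment> \<open>Time continuity is given in the essential supremum; for continuous slices this
    controls every point.\<close>
  have le: "norm (V x s - V x t) \<le> linf (\<lambda>x. V x s - V x t)"
    if "continuous_on UNIV (\<lambda>x. V x s)" "continuous_on UNIV (\<lambda>x. V x t)" "Linf (\<lambda>x. V x s)" "Linf (\<lambda>x. V x t)"
    for V :: "real^3 \<Rightarrow> real \<Rightarrow> real^3" and x
  proof -
    have c: "continuous_on UNIV (\<lambda>x. V x s - V x t)" by (intro continuous_intros that)
    have "norm (V x s - V x t) \<le> linf (\<lambda>x. V x s) + linf (\<lambda>x. V x t)" for x
      using norm_triangle_ineq4[of "V x s" "V x t"] norm_le_linf[OF that(1,3), of x] norm_le_linf[OF that(2,4), of x]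
      by linarith
    then show ?thesis using norm_le_linf[OF c Linf_continuous[OF c]] by blast
  qed
  have L: "Linf (\<lambda>x. U x s)" "Linf (\<lambda>x. U x t)" "Linf (\<lambda>x. B x s)" "Linf (\<lambda>x. B x t)"
    using mild sT tT unfolding mhd_mild_def by auto
  show ?thesis
  proof (rule that[of "s - t0"])
    show "norm (U x (t0 + (s - t0)) - U x t) \<le> \<eta>" for x
      using le[OF sl(1) cont(1) L(1,2), of x] s by simp
    show "norm (B x (t0 + (s - t0)) - B x t) \<le> \<eta>" for x
      using le[OF sl(2) cont(2) L(3,4), of x] s by simp
  qed (use s D tD t in \<open>auto simp: D_def\<close>)
qed

text \<open>Collecting powers leaves g^h * A times \<kappa> to the exponent 1 - h - \<alpha> * h.
  The lower bound on \<alpha> makes that exponent nonpositive, so the loss \<kappa> from the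
  analytic extension is absorbed by the lowered threshold.\<close>

lemma level_powr_le:
  fixes g \<kappa> A \<alpha> h :: real
  assumes "0 < g" "1 \<le> \<kappa>" "0 < A" "1 - h \<le> \<alpha> * h"
  shows "(g / \<kappa> powr \<alpha> * A) powr h * (\<kappa> * A) powr (1 - h) \<le> g powr h * A"
proof -
  have "(g / \<kappa> powr \<alpha> * A) powr h * (\<kappa> * A) powr (1 - h)
     = g powr h * (\<kappa> powr (1 - h) / \<kappa> powr (\<alpha> * h)) * (A powr h * A powr (1 - h))"
    using assms by (simp add: powr_mult powr_divide powr_powr)
  also have "A powr h * A powr (1 - h) = A" using assms by (simp add: powr_add[symmetric])
  also have "\<kappa> powr (1 - h) / \<kappa> powr (\<alpha> * h) \<le> 1"
    using assms powr_mono[of "1 - h" "\<alpha> * h" \<kappa>] by (simp add: divide_le_eq)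
  finally show ?thesis using assms by (simp add: mult_left_le mult_right_mono)
qed

text \<open>The two thresholds are matched: the h-th powers of \<gamma> and of (1 -
  \<gamma>^h)^(1/h) add up to 1, so the bounds for the two fields sum to the old norm.\<close>

lemma Anorm_decreases:
  assumes reg: "interval_of_regularity \<nu> \<mu> U0 B0 T U B" and data: "analyticity_data C4 T U B"
    and t0: "0 < t0" "t0 < T" and A: "0 < Anorm U B t0"
    and t: "t0 + T4 C4 (Anorm U B t0) / 4 \<le> t" "t \<le> t0 + T4 C4 (Anorm U B t0)" "t < T"
    and cont: "continuous_on UNIV (\<lambda>x. U x t)" "continuous_on UNIV (\<lambda>x. B x t)"
    and delta: "0 < \<delta>" "\<delta> < 1" and h: "h = 2 / pi * arcsin ((1 - \<delta>\<^sup>2) / (1 + \<delta>\<^sup>2))"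
    and alpha: "\<alpha> \<ge> (1 - h) / h" and gamma: "0 < \<gamma>" "\<gamma> < 1"
    and sparse: "\<forall>x0. \<exists>rU rB.
                  0 < rU \<and> rU \<le> rho C4 (T4 C4 (Anorm U B t0) / 4) \<and>
                  lin_sparse (superlevel U t (\<gamma> / (2 * C4) powr \<alpha> * Anorm U B t0)) \<delta> x0 rU \<and>
                  0 < rB \<and> rB \<le> rho C4 (T4 C4 (Anorm U B t0) / 4) \<and>
                  lin_sparse (superlevel B t ((1 - \<gamma> powr h) powr (1 / h) / (2 * C4) powr \<alpha>
                                               * Anorm U B t0)) \<delta> x0 rB"
  shows "Anorm U B t \<le> Anorm U B t0"
proof -
  define a where "a = Anorm U B t0"
  define D where "D = T4 C4 a"
  define \<kappa> where "\<kappa> = 2 * C4"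
  define gB where "gB = (1 - \<gamma> powr h) powr (1 / h)"
  have C4: "C4 \<ge> 1" using data by (simp add: analyticity_data_def)
  have k: "\<kappa> \<ge> 2" using C4 by (simp add: \<kappa>_def)
  have D: "D > 0" using T4_antimono(2)[OF C4 A order_refl] by (simp add: D_def a_def)
  have hb: "0 < h" "h \<le> 1"
  proof -
    have "h = 2 / pi * (pi / 2 - 2 * arctan \<delta>)" unfolding h using arcsin_eq_arctan[of \<delta>] delta by simp
    then have "h = 1 - 4 * arctan \<delta> / pi" by (simp add: right_diff_distrib)
    moreover have "0 < arctan \<delta>" "arctan \<delta> < pi / 4" using delta arctan_less_iff[of \<delta> 1] arctan_one by auto
    ultimately show "0 < h" "h \<le> 1" by (auto simp: divide_less_eq)
  qed
  have al: "0 \<le> \<alpha>" "1 - h \<le> \<alpha> * h"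
    using alpha hb by (auto simp: divide_le_eq intro: order_trans[OF _ alpha])
  have gh: "0 < \<gamma> powr h" "\<gamma> powr h < 1" using gamma hb powr_less_mono2[of h \<gamma> 1] by auto
  have gB: "0 < gB" "gB \<le> 1" "gB powr h = 1 - \<gamma> powr h"
    using gh hb by (auto simp: gB_def powr_powr intro: powr_le1)
  \<comment> \<open>Both thresholds lie strictly below the bound \<kappa> * a of the extension; this
    gap is the room for raising the level by \<eta>.\<close>
  have lev: "0 < g / \<kappa> powr \<alpha> * a" "g / \<kappa> powr \<alpha> * a < \<kappa> * a" if "0 < g" "g \<le> 1" for g
  proof -
    have "\<kappa> powr \<alpha> \<ge> 1" using k al by (simp add: ge_one_powr_ge_zero)
    then have "g / \<kappa> powr \<alpha> < \<kappa>" "0 < g / \<kappa> powr \<alpha>"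
      using that k mult_mono[of 2 \<kappa> 1 "\<kappa> powr \<alpha>"] by (auto simp: divide_less_eq mult.commute)
    then show "0 < g / \<kappa> powr \<alpha> * a" "g / \<kappa> powr \<alpha> * a < \<kappa> * a"
      using A unfolding a_def by (auto intro: mult_strict_right_mono simp del: times_divide_eq_left)
  qed
  have approx: "\<exists>uU FU uB FB. analytic3_on (strip (rho C4 (D / 4))) FU \<and> (\<forall>x. FU (cvec x) = cvec (uU x)) \<and>
       (\<forall>z\<in>strip (rho C4 (D / 4)). norm (FU z) \<le> \<kappa> * a) \<and> (\<forall>x. norm (uU x - U x t) \<le> \<eta>) \<and>
       analytic3_on (strip (rho C4 (D / 4))) FB \<and> (\<forall>x. FB (cvec x) = cvec (uB x)) \<and>
       (\<forall>z\<in>strip (rho C4 (D / 4)). norm (FB z) \<le> \<kappa> * a) \<and> (\<forall>x. norm (uB x - B x t) \<le> \<eta>)"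
    if "\<eta> > 0" for \<eta>
  proof -
    obtain \<tau> where tau: "D / 4 \<le> \<tau>" "\<tau> < D" "t0 + \<tau> < T"
      "\<And>x. norm (U x (t0 + \<tau>) - U x t) \<le> \<eta>" "\<And>x. norm (B x (t0 + \<tau>) - B x t) \<le> \<eta>"
      using ex_nearby_time[OF reg data t0 A t cont \<open>\<eta> > 0\<close>] unfolding D_def a_def by blast
    have "0 < \<tau>" using tau D by simp
    then obtain FU FB where F: "analytic3_on (strip (rho C4 \<tau>)) FU" "analytic3_on (strip (rho C4 \<tau>)) FB"
      "\<And>x. FU (cvec x) = cvec (U x (t0 + \<tau>))" "\<And>x. FB (cvec x) = cvec (B x (t0 + \<tau>))"
      "\<And>z. z \<in> strip (rho C4 \<tau>) \<Longrightarrow> norm (FU z) + norm (FB z) \<le> \<kappa> * a"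
      using analyticity_dataE[OF data t0, of \<tau>] tau unfolding D_def a_def \<kappa>_def by blast
    have sub: "strip (rho C4 (D / 4)) \<subseteq> strip (rho C4 \<tau>)"
      using tau(1) C4 by (intro strip_mono) (simp add: rho_def divide_right_mono)
    have "norm (FU z) \<le> \<kappa> * a" "norm (FB z) \<le> \<kappa> * a" if "z \<in> strip (rho C4 (D / 4))" for z
      using F(5)[OF subsetD[OF sub that]] norm_ge_zero[of "FU z"] norm_ge_zero[of "FB z"] by linarith+
    then show ?thesis
      using analytic3_on_subset[OF F(1) sub] analytic3_on_subset[OF F(2) sub] F(3,4) tau(4,5)
      by - (rule exI[of _ "\<lambda>x. U x (t0 + \<tau>)"], rule exI[of _ FU], rule exI[of _ "\<lambda>x. B x (t0 + \<tau>)"], rule exI[of _ FB], auto)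
  qed
  have U: "norm (U x t) \<le> \<gamma> powr h * a" for x
  proof -
    obtain r where r: "0 < r" "r \<le> rho C4 (D / 4)" "lin_sparse {x. norm (U x t) > \<gamma> / \<kappa> powr \<alpha> * a} \<delta> x r"
      using sparse unfolding superlevel_def D_def a_def \<kappa>_def by blast
    have "norm (U x t) \<le> (\<gamma> / \<kappa> powr \<alpha> * a) powr h * (\<kappa> * a) powr (1 - h)"
      by (rule sparse_level_bound[OF cont(1) lev r(1,2) delta h r(3)]) (use gamma in auto, use approx in blast)
    also have "\<dots> \<le> \<gamma> powr h * a" using gamma k A al by (intro level_powr_le) (auto simp: a_def)
    finally show ?thesis .
  qed
  have B: "norm (B x t) \<le> (1 - \<gamma> powr h) * a" for x
  proof -
    obtain r where r: "0 < r" "r \<le> rho C4 (D / 4)" "lin_sparse {x. norm (B x t) > gB / \<kappa> powr \<alpha> * a} \<delta> x r"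
      using sparse unfolding superlevel_def D_def a_def \<kappa>_def gB_def by blast
    have "norm (B x t) \<le> (gB / \<kappa> powr \<alpha> * a) powr h * (\<kappa> * a) powr (1 - h)"
      by (rule sparse_level_bound[OF cont(2) lev r(1,2) delta h r(3)]) (use gB in auto, use approx in blast)
    also have "\<dots> \<le> gB powr h * a" using gB k A al by (intro level_powr_le) (auto simp: a_def)
    finally show ?thesis by (simp add: gB)
  qed
  have "Anorm U B t \<le> \<gamma> powr h * a + (1 - \<gamma> powr h) * a"
    unfolding Anorm_def using linf_le[OF cont(1) U] linf_le[OF cont(2) B] by simp
  then show ?thesis by (simp add: a_def algebra_simps)
qed

theorem theorem12:
  fixes \<nu> \<mu> T C4 \<delta> h \<alpha> \<gamma> :: real
    and U0 B0 :: "real^3 \<Rightarrow> real^3"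
    and U B :: "real^3 \<Rightarrow> real \<Rightarrow> real^3"
  assumes "\<nu> > 0" and "\<mu> > 0"
    and "Linf U0" and "Linf B0" and "div_free U0" and "div_free B0"
    and "interval_of_regularity \<nu> \<mu> U0 B0 T U B"
    and "analyticity_data C4 T U B"
    and "0 < \<delta>" and "\<delta> < 1"
    and "h = 2 / pi * arcsin ((1 - \<delta>\<^sup>2) / (1 + \<delta>\<^sup>2))"
    and "\<alpha> \<ge> (1 - h) / h"
    and "0 < \<gamma>" and "\<gamma> < 1"
    and "\<exists>\<epsilon>>0. \<forall>t0\<in>{T - \<epsilon><..<T}. t0 > 0 \<longrightarrow>
           (t0 + T4 C4 (Anorm U B t0) > T \<or>
            (\<exists>t. t0 + T4 C4 (Anorm U B t0) / 4 \<le> t \<and> t \<le> t0 + T4 C4 (Anorm U B t0) \<and> t < T \<and>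
               (\<forall>x0. \<exists>rU rB.
                  0 < rU \<and> rU \<le> rho C4 (T4 C4 (Anorm U B t0) / 4) \<and>
                  lin_sparse (superlevel U t (\<gamma> / (2 * C4) powr \<alpha> * Anorm U B t0)) \<delta> x0 rU \<and>
                  0 < rB \<and> rB \<le> rho C4 (T4 C4 (Anorm U B t0) / 4) \<and>
                  lin_sparse (superlevel B t ((1 - \<gamma> powr h) powr (1 / h) / (2 * C4) powr \<alpha>
                                               * Anorm U B t0)) \<delta> x0 rB)))"
  shows "not_singular_time T U B"
proof (rule ccontr)
  assume sing: "\<not> not_singular_time T U B"
  note reg = assms(7) and data = assms(8)
  have C4: "C4 \<ge> 1" using data by (simp add: analyticity_data_def)
  have T: "0 < T" and mild: "mhd_mild \<nu> \<mu> U0 B0 T U B" using reg by (auto simp: interval_of_regularity_def)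
  obtain \<epsilon> where eps: "\<epsilon> > 0" and alt: "\<And>t0. T - \<epsilon> < t0 \<Longrightarrow> t0 < T \<Longrightarrow> 0 < t0 \<Longrightarrow>
           (t0 + T4 C4 (Anorm U B t0) > T \<or>
            (\<exists>t. t0 + T4 C4 (Anorm U B t0) / 4 \<le> t \<and> t \<le> t0 + T4 C4 (Anorm U B t0) \<and> t < T \<and>
               (\<forall>x0. \<exists>rU rB.
                  0 < rU \<and> rU \<le> rho C4 (T4 C4 (Anorm U B t0) / 4) \<and>
                  lin_sparse (superlevel U t (\<gamma> / (2 * C4) powr \<alpha> * Anorm U B t0)) \<delta> x0 rU \<and>
                  0 < rB \<and> rB \<le> rho C4 (T4 C4 (Anorm U B t0) / 4) \<and>
                  lin_sparse (superlevel B t ((1 - \<gamma> powr h) powr (1 / h) / (2 * C4) powr \<alpha>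
                                               * Anorm U B t0)) \<delta> x0 rB)))"
    using assms(15) by auto
  define a where "a = max 0 (T - \<epsilon>)"
  have a: "0 \<le> a" "a < T" using eps T by (auto simp: a_def)
  \<comment> \<open>Alternative (1) at any such time would bound the solution up to \<open>T\<close>
    by \<open>not_singular_of_T4\<close>, against the assumption.\<close>
  have case2: "\<exists>t. t0 + T4 C4 (Anorm U B t0) / 4 \<le> t \<and> t \<le> t0 + T4 C4 (Anorm U B t0) \<and> t < T \<and>
               (\<forall>x0. \<exists>rU rB.
                  0 < rU \<and> rU \<le> rho C4 (T4 C4 (Anorm U B t0) / 4) \<and>
                  lin_sparse (superlevel U t (\<gamma> / (2 * C4) powr \<alpha> * Anorm U B t0)) \<delta> x0 rU \<and>
                  0 < rB \<and> rB \<le> rho C4 (T4 C4 (Anorm U B t0) / 4) \<and>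
                  lin_sparse (superlevel B t ((1 - \<gamma> powr h) powr (1 / h) / (2 * C4) powr \<alpha>
                                               * Anorm U B t0)) \<delta> x0 rB)"
    if "a < t0" "t0 < T" for t0
    using alt[of t0] not_singular_of_T4[OF data, of t0] sing that by (auto simp: a_def)
  \<comment> \<open>If the norm vanished, the junk value \<open>T4 C4 0 = 0\<close> would leave no admissible radius.\<close>
  have pos: "0 < Anorm U B s" if s: "a < s" "s < T" for s
  proof -
    have "0 \<le> Anorm U B s"
      using mild s a linf_nonneg unfolding mhd_mild_def Anorm_def by (intro add_nonneg_nonneg) auto
    moreover have "Anorm U B s \<noteq> 0"
    proof
      assume "Anorm U B s = 0"
      then have "rho C4 (T4 C4 (Anorm U B s) / 4) = 0" by (simp add: T4_def rho_def)
      moreover obtain r where "0 < r" "r \<le> rho C4 (T4 C4 (Anorm U B s) / 4)" using case2[OF s] by blast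
      ultimately show False by simp
    qed
    ultimately show ?thesis by simp
  qed
  have step: "\<exists>t. t0 + T4 C4 (Anorm U B t0) / 4 \<le> t \<and> t < T \<and> Anorm U B t \<le> Anorm U B t0"
    if t0: "a < t0" "t0 < T" for t0
  proof -
    obtain t where t: "t0 + T4 C4 (Anorm U B t0) / 4 \<le> t" "t \<le> t0 + T4 C4 (Anorm U B t0)" "t < T"
      and sp: "\<forall>x0. \<exists>rU rB.
                  0 < rU \<and> rU \<le> rho C4 (T4 C4 (Anorm U B t0) / 4) \<and>
                  lin_sparse (superlevel U t (\<gamma> / (2 * C4) powr \<alpha> * Anorm U B t0)) \<delta> x0 rU \<and>
                  0 < rB \<and> rB \<le> rho C4 (T4 C4 (Anorm U B t0) / 4) \<and>
                  lin_sparse (superlevel B t ((1 - \<gamma> powr h) powr (1 / h) / (2 * C4) powr \<alpha>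
                                               * Anorm U B t0)) \<delta> x0 rB"
      using case2[OF t0] by blast
    have "a < t" using t t0 T4_antimono(2)[OF C4 pos[OF t0] order_refl] by linarith
    have "Anorm U B t \<le> Anorm U B t0"
      using t0 a by (intro Anorm_decreases[OF reg data _ _ pos[OF t0] t
          regular_slices_continuous[OF reg data a(1) pos \<open>a < t\<close> t(3)] assms(9-14) sp]) auto
    then show ?thesis using t by blast
  qed
  define s where "s = (a + T) / 2"
  have s: "a < s" "s < T" using a by (auto simp: s_def)
  \<comment> \<open>A quarter of the analyticity time at the start. Since the norm never exceeds its
    starting value along the iteration, every later step advances by at least this amount.\<close>
  define d where "d = T4 C4 (Anorm U B s) / 4"
  have d: "d > 0" using T4_antimono(2)[OF C4 pos[OF s] order_refl] by (simp add: d_def)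
  have "\<exists>t. s + real n * d \<le> t \<and> t < T \<and> Anorm U B t \<le> Anorm U B s" for n
  proof (induction n)
    case 0
    then show ?case using s by auto
  next
    case (Suc n)
    then obtain t where t: "s + real n * d \<le> t" "t < T" "Anorm U B t \<le> Anorm U B s" by blast
    have at: "a < t" using t s d mult_nonneg_nonneg[of "real n" d] by linarith
    obtain t' where t': "t + T4 C4 (Anorm U B t) / 4 \<le> t'" "t' < T" "Anorm U B t' \<le> Anorm U B t"
      using step[OF at t(2)] by blast
    have "d \<le> T4 C4 (Anorm U B t) / 4"
      using T4_antimono(1)[OF C4 pos[OF at t(2)] t(3)] by (simp add: d_def)
    then have "s + real (Suc n) * d \<le> t'" using t t' by (simp add: algebra_simps)
    then show ?case using t' t by force
  qed
  moreover obtain n where "T / d < real n" using reals_Archimedean2 by blast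
  ultimately obtain t where "s + real n * d \<le> t" "t < T" by blast
  moreover have "T < real n * d" using \<open>T / d < real n\<close> d by (simp add: divide_less_eq)
  ultimately show False using s a by linarith
qed

end
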